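(* Let $M\ge 2$ be an integer and let $\kappa_1,\kappa_2\in\mathbb{R}$ satisfy $\kappa_1>0$ and $\kappa_1+4\kappa_2>0$. Let $\Theta$ be the memory kernel of the generalized Langevin equation for the one-dimensional lattice with first and second neighbor force constants $\kappa_1,\kappa_2$, where the coarse-grained variables are defined by the piecewise constant averaging operator with block size $M$. Explicitly, $$\Theta_{0,0}(0)=\frac{1}{2\pi}\int_0^{2\pi} Q_1^{\intercal}\widehat{\mathcal A}(\xi)Q_2\left(Q_2^{\intercal}\widehat{\mathcal A}(\xi)Q_2\right)^{-1}Q_2^{\intercal}\widehat{\mathcal A}(\xi)Q_1\,d\xi .$$ Then $$0\le \Theta_{0,0}(0)\le \frac{2\kappa_1+4\kappa_2}{M}.$$
   Context: Lattice operator. Set $\kappa_0=2(\kappa_1+\kappa_2)$ and let $\mathcal A$ act on $\ell^2(\mathbb Z)$ by $(\mathcal A u)_j=-\kappa_2u_{j-2}-\kappa_1u_{j-1}+\kappa_0u_j-\kappa_1u_{j+1}-\kappa_2u_{j+2}$. Grouping the sites into consecutive blocks of $M$ sites, $\mathcal A$ becomes a block tridiagonal block Toeplitz operator with $M\times M$ blocks: diagonal block $A_0$, sub-diagonal block $A_1$, super-diagonal block $A_{-1}=A_1^{\intercal}$. Here $(A_0)_{ij}=\kappa_0$ if $i=j$, $-\kappa_1$ if $|i-j|=1$, $-\kappa_2$ if $|i-j|=2$, and $0$ otherwise; the only nonzero entries of $A_1$ are $A_1(1,M)=-\kappa_1$ and $A_1(1,M-1)=A_1(2,M)=-\kappa_2$.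 The Fourier transform (symbol) is $$\widehat{\mathcal A}(\xi)=A_0+e^{-i\xi}A_1+e^{i\xi}A_1^{\intercal},\qquad \xi\in(0,2\pi].$$ Piecewise constant averaging. $Q_1=\frac{1}{\sqrt M}(1,1,\dots,1)^{\intercal}\in\mathbb R^M$, and $Q_2\in\mathbb R^{M\times(M-1)}$ is any matrix such that $[Q_1\;Q_2]$ is an orthogonal $M\times M$ matrix. The averaging operator $\Phi$ is block diagonal with diagonal block $Q_1$, and $\Psi$ (whose columns span the orthogonal complement) is block diagonal with diagonal block $Q_2$. Kernel. The memory kernel is $\Theta(t)=\Phi^{\intercal}\mathcal A\Psi\cos(\Omega t)\Omega^{-2}\Psi^{\intercal}\mathcal A\Phi$ with $\Omega^2=\Psi^{\intercal}\mathcal A\Psi$; its $(0,0)$ entry at $t=0$ is the integral displayed in the claim. *)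

theory Defs
  imports
    "HOL-Analysis.Analysis"
    "Jordan_Normal_Form.Gauss_Jordan_Elimination"
begin

definition l2 :: "(int \<Rightarrow> real) set" where
  "l2 = {u. (\<lambda>j. (u j)\<^sup>2) summable_on UNIV}"

definition lattice_op :: "real \<Rightarrow> real \<Rightarrow> (int \<Rightarrow> real) \<Rightarrow> int \<Rightarrow> real" where
  "lattice_op \<kappa>\<^sub>1 \<kappa>\<^sub>2 u j =
     - \<kappa>\<^sub>2 * u (j - 2) - \<kappa>\<^sub>1 * u (j - 1) + 2 * (\<kappa>\<^sub>1 + \<kappa>\<^sub>2) * u j
     - \<kappa>\<^sub>1 * u (j + 1) - \<kappa>\<^sub>2 * u (j + 2)"

text \<open>
  The bi-infinite block diagonal matrix with all diagonal blocks equal to \<open>B\<close>, applied to a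
  sequence. If \<open>B\<close> has \<open>r\<close> rows and \<open>c\<close> columns, block number \<open>J\<close> of the argument consists of the
  sites \<open>J * c, \<dots>, J * c + c - 1\<close>, block number \<open>J\<close> of the result of \<open>J * r, \<dots>, J * r + r - 1\<close>.
  The transposed operator is \<open>block_diag (transpose_mat B)\<close>.
\<close>

definition block_diag :: "real mat \<Rightarrow> (int \<Rightarrow> real) \<Rightarrow> int \<Rightarrow> real" where
  "block_diag B v j =
     (\<Sum>l<dim_col B. B $$ (nat (j mod int (dim_row B)), l) *
        v ((j div int (dim_row B)) * int (dim_col B) + int l))"

definition op_entry :: "((int \<Rightarrow> real) \<Rightarrow> int \<Rightarrow> real) \<Rightarrow> int \<Rightarrow> int \<Rightarrow> real" where
  "op_entry T m n = T (\<lambda>j. if j = n then 1 else 0) m"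

text \<open>
  \<open>cos_sqrt S t\<close> is \<open>cos (\<Omega> t)\<close> for \<open>\<Omega>\<^sup>2 = S\<close>: the cosine series contains only even powers of
  \<open>\<Omega>\<close>, so for bounded \<open>S\<close> it is the power series \<open>\<Sum>k. (-1)^k t^(2k) / (2k)! S^k\<close>.
\<close>

definition cos_sqrt ::
    "((int \<Rightarrow> real) \<Rightarrow> int \<Rightarrow> real) \<Rightarrow> real \<Rightarrow> (int \<Rightarrow> real) \<Rightarrow> int \<Rightarrow> real" where
  "cos_sqrt S t v j = (\<Sum>k. (- 1) ^ k * t ^ (2 * k) / fact (2 * k) * (S ^^ k) v j)"

definition avg_col :: "nat \<Rightarrow> real mat" where
  "avg_col M = mat M 1 (\<lambda>_. 1 / sqrt (real M))"

definition hcat :: "real mat \<Rightarrow> real mat \<Rightarrow> real mat" where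
  "hcat A B = mat (dim_row A) (dim_col A + dim_col B)
     (\<lambda>(i, j). if j < dim_col A then A $$ (i, j) else B $$ (i, j - dim_col A))"

text \<open>
  The predicate \<open>orthogonal_mat\<close> of the matrix library only demands pairwise orthogonal columns,
  not orthonormal ones.
\<close>

definition orthogonal_square_mat :: "real mat \<Rightarrow> bool" where
  "orthogonal_square_mat P \<longleftrightarrow> square_mat P \<and>
     transpose_mat P * P = 1\<^sub>m (dim_row P) \<and> P * transpose_mat P = 1\<^sub>m (dim_row P)"

definition complementary_cols :: "nat \<Rightarrow> real mat \<Rightarrow> bool" where
  "complementary_cols M Q2 \<longleftrightarrow>
     Q2 \<in> carrier_mat M (M - 1) \<and> orthogonal_square_mat (hcat (avg_col M) Q2)"

definition Omega_sq :: "real \<Rightarrow> real \<Rightarrow> real mat \<Rightarrow> (int \<Rightarrow> real) \<Rightarrow> int \<Rightarrow> real" where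
  "Omega_sq \<kappa>\<^sub>1 \<kappa>\<^sub>2 Q2 =
     block_diag (transpose_mat Q2) \<circ> lattice_op \<kappa>\<^sub>1 \<kappa>\<^sub>2 \<circ> block_diag Q2"

text \<open>
  In the following composition, \<open>inv_into l2 (Omega_sq \<kappa>\<^sub>1 \<kappa>\<^sub>2 Q2)\<close> is \<open>\<Omega>\<^sup>-\<^sup>2\<close>, the inverse of
  \<open>\<Omega>\<^sup>2\<close> as an operator on square summable sequences.
\<close>

definition memory_kernel ::
    "real \<Rightarrow> real \<Rightarrow> nat \<Rightarrow> real mat \<Rightarrow> real \<Rightarrow> (int \<Rightarrow> real) \<Rightarrow> int \<Rightarrow> real" where
  "memory_kernel \<kappa>\<^sub>1 \<kappa>\<^sub>2 M Q2 t =
     block_diag (transpose_mat (avg_col M)) \<circ> lattice_op \<kappa>\<^sub>1 \<kappa>\<^sub>2 \<circ> block_diag Q2 \<circ>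
     cos_sqrt (Omega_sq \<kappa>\<^sub>1 \<kappa>\<^sub>2 Q2) t \<circ> inv_into l2 (Omega_sq \<kappa>\<^sub>1 \<kappa>\<^sub>2 Q2) \<circ>
     block_diag (transpose_mat Q2) \<circ> lattice_op \<kappa>\<^sub>1 \<kappa>\<^sub>2 \<circ> block_diag (avg_col M)"

text \<open>Matrix indices start at \<open>0\<close>.\<close>

definition diag_block :: "real \<Rightarrow> real \<Rightarrow> nat \<Rightarrow> real mat" where
  "diag_block \<kappa>\<^sub>1 \<kappa>\<^sub>2 M = mat M M (\<lambda>(i, j).
     if i = j then 2 * (\<kappa>\<^sub>1 + \<kappa>\<^sub>2)
     else if \<bar>int i - int j\<bar> = 1 then - \<kappa>\<^sub>1
     else if \<bar>int i - int j\<bar> = 2 then - \<kappa>\<^sub>2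
     else 0)"

definition sub_block :: "real \<Rightarrow> real \<Rightarrow> nat \<Rightarrow> real mat" where
  "sub_block \<kappa>\<^sub>1 \<kappa>\<^sub>2 M = mat M M (\<lambda>(i, j).
     if (i, j) = (0, M - 1) then - \<kappa>\<^sub>1
     else if (i, j) = (0, M - 2) \<or> (i, j) = (1, M - 1) then - \<kappa>\<^sub>2
     else 0)"

abbreviation cmat :: "real mat \<Rightarrow> complex mat" where
  "cmat \<equiv> map_mat complex_of_real"

definition symbol :: "real \<Rightarrow> real \<Rightarrow> nat \<Rightarrow> real \<Rightarrow> complex mat" where
  "symbol \<kappa>\<^sub>1 \<kappa>\<^sub>2 M \<xi> =
     cmat (diag_block \<kappa>\<^sub>1 \<kappa>\<^sub>2 M)
     + exp (- \<i> * complex_of_real \<xi>) \<cdot>\<^sub>m cmat (sub_block \<kappa>\<^sub>1 \<kappa>\<^sub>2 M)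
     + exp (\<i> * complex_of_real \<xi>) \<cdot>\<^sub>m cmat (transpose_mat (sub_block \<kappa>\<^sub>1 \<kappa>\<^sub>2 M))"

definition kernel_symbol :: "real \<Rightarrow> real \<Rightarrow> nat \<Rightarrow> real mat \<Rightarrow> real \<Rightarrow> complex mat" where
  "kernel_symbol \<kappa>\<^sub>1 \<kappa>\<^sub>2 M Q2 \<xi> =
     (let A = symbol \<kappa>\<^sub>1 \<kappa>\<^sub>2 M \<xi>; q1 = cmat (avg_col M); q2 = cmat Q2
      in transpose_mat q1 * A * q2
         * the (mat_inverse (transpose_mat q2 * A * q2))
         * (transpose_mat q2 * A * q1))"

end

theory Submission
  imports Defs "Jordan_Normal_Form.Determinant"
begin

text \<open>
  The quadratic form of the lattice operator dominates a positive multiple of the sum of the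
  squared first differences, both on square summable sequences and on quasi-periodic ones. The
  block means of functions in the range of \<open>\<Psi>\<close> vanish, hence \<open>\<Omega>\<^sup>2\<close> is injective on \<open>l2\<close>
  and its symbol \<open>S(\<xi>)\<close> is invertible for every \<open>\<xi>\<close>. The Fourier coefficients of \<open>S\<^sup>-\<^sup>1 b\<close>, where
  \<open>b\<close> is the symbol of \<open>\<Psi>\<^sup>T A \<Phi>\<close>, are square summable by Bessel's inequality and solve
  \<open>\<Omega>\<^sup>2 w = \<Psi>\<^sup>T A \<Phi> \<delta>\<^sub>0\<close>; this yields the integral formula. With \<open>p = \<Phi> \<delta>\<^sub>0\<close> and
  \<open>u = \<Psi> w\<close>, the kernel entry equals \<open>\<langle>u, A u\<rangle> = \<langle>p, A u\<rangle>\<close>, so the two bounds are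
  \<open>0 \<le> \<langle>u, A u\<rangle>\<close> and \<open>0 \<le> \<langle>p - u, A (p - u)\<rangle> = \<langle>p, A p\<rangle> - \<langle>u, A u\<rangle>\<close>.
\<close>

section \<open>The lattice operator on square summable sequences\<close>

lemma l2_mult_summable:
  assumes "u \<in> l2" "v \<in> l2"
  shows "(\<lambda>j. u j * v j) summable_on UNIV"
proof -
  have "(\<lambda>j. norm (u j * v j)) summable_on UNIV"
  proof (rule Infinite_Sum.abs_summable_on_comparison_test')
    show "(\<lambda>j. (u j)\<^sup>2 + (v j)\<^sup>2) summable_on UNIV"
      using assms unfolding l2_def by (intro summable_on_add) auto
    show "norm (u j * v j) \<le> (u j)\<^sup>2 + (v j)\<^sup>2" for j
      using sum_squares_bound[of "\<bar>u j\<bar>" "\<bar>v j\<bar>"] mult_nonneg_nonneg[of "\<bar>u j\<bar>" "\<bar>v j\<bar>"]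
      unfolding real_norm_def abs_mult power2_abs by linarith
  qed
  then show ?thesis by (rule abs_summable_summable)
qed

lemma l2_add: "u \<in> l2 \<Longrightarrow> v \<in> l2 \<Longrightarrow> (\<lambda>j. u j + v j) \<in> l2"
  using l2_mult_summable[of u v] unfolding l2_def
  by (simp add: power2_sum mult.assoc summable_on_add summable_on_cmult_right)

lemma l2_scale: "u \<in> l2 \<Longrightarrow> (\<lambda>j. c * u j) \<in> l2"
  unfolding l2_def by (simp add: power_mult_distrib summable_on_cmult_right)

lemma l2_diff: "u \<in> l2 \<Longrightarrow> v \<in> l2 \<Longrightarrow> (\<lambda>j. u j - v j) \<in> l2"
  using l2_add[of u "\<lambda>j. (- 1) * v j"] l2_scale[of v "- 1"] by simp

lemma bij_shift: "bij (\<lambda>j::int. j + k)"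
  by (rule bij_betw_byWitness[where f' = "\<lambda>j. j - k"]) auto

lemma infsum_shift: "(\<Sum>\<^sub>\<infinity>j. f (j + k)) = (\<Sum>\<^sub>\<infinity>j::int. f j)"
  using infsum_reindex_bij_betw[OF bij_shift] .

lemma l2_shift: "u \<in> l2 \<Longrightarrow> (\<lambda>j. u (j + k)) \<in> l2"
  unfolding l2_def using summable_on_reindex_bij_betw[OF bij_shift, of "\<lambda>j. (u j)\<^sup>2"] by simp

lemma l2_lattice_op:
  assumes "u \<in> l2" shows "lattice_op \<kappa>\<^sub>1 \<kappa>\<^sub>2 u \<in> l2"
proof -
  \<comment> \<open>Differences of indices are written as sums with negative numbers, so that each
    term matches \<open>l2_shift\<close>.\<close>
  have "(\<lambda>j. (- \<kappa>\<^sub>2) * u (j + (- 2)) + (- \<kappa>\<^sub>1) * u (j + (- 1)) + 2 * (\<kappa>\<^sub>1 + \<kappa>\<^sub>2) * u j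
     + (- \<kappa>\<^sub>1) * u (j + 1) + (- \<kappa>\<^sub>2) * u (j + 2)) \<in> l2"
    by (intro l2_add l2_scale l2_shift assms)
  also have "(\<lambda>j. (- \<kappa>\<^sub>2) * u (j + (- 2)) + (- \<kappa>\<^sub>1) * u (j + (- 1)) + 2 * (\<kappa>\<^sub>1 + \<kappa>\<^sub>2) * u j
     + (- \<kappa>\<^sub>1) * u (j + 1) + (- \<kappa>\<^sub>2) * u (j + 2)) = lattice_op \<kappa>\<^sub>1 \<kappa>\<^sub>2 u"
    by (simp add: fun_eq_iff lattice_op_def)
  finally show ?thesis .
qed

section \<open>Inner product, symmetry and energy\<close>

definition l2_inner :: "(int \<Rightarrow> real) \<Rightarrow> (int \<Rightarrow> real) \<Rightarrow> real" where
  "l2_inner u v = (\<Sum>\<^sub>\<infinity>j. u j * v j)"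

lemma l2_inner_commute: "l2_inner u v = l2_inner v u"
  by (simp add: l2_inner_def mult.commute)

lemma l2_inner_add_right:
  "u \<in> l2 \<Longrightarrow> v \<in> l2 \<Longrightarrow> w \<in> l2 \<Longrightarrow>
   l2_inner u (\<lambda>j. v j + w j) = l2_inner u v + l2_inner u w"
  unfolding l2_inner_def distrib_left by (intro infsum_add l2_mult_summable)

lemma l2_inner_scale_right: "l2_inner u (\<lambda>j. c * v j) = c * l2_inner u v"
  unfolding l2_inner_def by (simp add: infsum_cmult_right' mult.left_commute)

lemma l2_inner_diff_right:
  assumes "u \<in> l2" "v \<in> l2" "w \<in> l2"
  shows "l2_inner u (\<lambda>j. v j - w j) = l2_inner u v - l2_inner u w"
  using l2_inner_add_right[OF assms(1,2) l2_scale[OF assms(3), of "- 1"]]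
    l2_inner_scale_right[of u "- 1" w] by simp

lemma l2_inner_diff_left:
  assumes "u \<in> l2" "v \<in> l2" "w \<in> l2"
  shows "l2_inner (\<lambda>j. v j - w j) u = l2_inner v u - l2_inner w u"
  using l2_inner_diff_right[OF assms] by (simp add: l2_inner_commute)

lemma l2_inner_self_nonneg: "0 \<le> l2_inner u u"
  unfolding l2_inner_def by (intro infsum_nonneg) simp

lemma l2_inner_self_eq_0: "u \<in> l2 \<Longrightarrow> l2_inner u u \<le> 0 \<Longrightarrow> u j = 0"
  using nonneg_infsum_le_0D[of "\<lambda>j. u j * u j" UNIV j] l2_mult_summable[of u u]
  by (auto simp: l2_inner_def)

lemma l2_inner_shift: "l2_inner u (\<lambda>j. v (j + k)) = l2_inner (\<lambda>j. u (j + (- k))) v"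
  unfolding l2_inner_def using infsum_shift[of "\<lambda>j. u (j + (- k)) * v j" k] by simp

lemma l2_inner_lattice_op:
  assumes "u \<in> l2" "v \<in> l2"
  shows "l2_inner u (lattice_op \<kappa>\<^sub>1 \<kappa>\<^sub>2 v) =
    - \<kappa>\<^sub>2 * l2_inner u (\<lambda>j. v (j + (- 2))) - \<kappa>\<^sub>1 * l2_inner u (\<lambda>j. v (j + (- 1)))
    + 2 * (\<kappa>\<^sub>1 + \<kappa>\<^sub>2) * l2_inner u v
    - \<kappa>\<^sub>1 * l2_inner u (\<lambda>j. v (j + 1)) - \<kappa>\<^sub>2 * l2_inner u (\<lambda>j. v (j + 2))"
proof -
  have "lattice_op \<kappa>\<^sub>1 \<kappa>\<^sub>2 v = (\<lambda>j. (- \<kappa>\<^sub>2) * v (j + (- 2)) + (- \<kappa>\<^sub>1) * v (j + (- 1))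
      + 2 * (\<kappa>\<^sub>1 + \<kappa>\<^sub>2) * v j + (- \<kappa>\<^sub>1) * v (j + 1) + (- \<kappa>\<^sub>2) * v (j + 2))"
    by (simp add: fun_eq_iff lattice_op_def)
  then show ?thesis
    using assms by (simp only: l2_inner_add_right l2_inner_scale_right l2_add l2_scale l2_shift)
qed

text \<open>The adjoint of the shift by \<open>k\<close> is the shift by \<open>- k\<close>, and the
  coefficients of the operator are even in the offset.\<close>

lemma lattice_op_symmetric:
  assumes "u \<in> l2" "v \<in> l2"
  shows "l2_inner u (lattice_op \<kappa>\<^sub>1 \<kappa>\<^sub>2 v) = l2_inner (lattice_op \<kappa>\<^sub>1 \<kappa>\<^sub>2 u) v"
  unfolding l2_inner_lattice_op[OF assms]
    l2_inner_commute[of "lattice_op \<kappa>\<^sub>1 \<kappa>\<^sub>2 u"] l2_inner_lattice_op[OF assms(2,1)]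
  using l2_inner_shift[of u v 1] l2_inner_shift[of u v "- 1"]
    l2_inner_shift[of u v 2] l2_inner_shift[of u v "- 2"]
  by (simp add: l2_inner_commute[of v])

text \<open>
  Here \<open>a\<close> and \<open>b\<close> stand for the sums of squares of the first differences \<open>u (j + 1) - u j\<close> and of
  \<open>u (j + 2) - u j\<close>; \<open>4 * a - b\<close> is the sum of squares of the second differences.
\<close>

lemma energy_lower_bound:
  fixes \<kappa>\<^sub>1 \<kappa>\<^sub>2 a b :: real
  assumes "0 \<le> b" "b \<le> 4 * a"
  shows "min \<kappa>\<^sub>1 (\<kappa>\<^sub>1 + 4 * \<kappa>\<^sub>2) * a \<le> \<kappa>\<^sub>1 * a + \<kappa>\<^sub>2 * b"
proof (cases "\<kappa>\<^sub>2 \<ge> 0")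
  case True
  then show ?thesis using assms by (simp add: min_def)
next
  case False
  then have "\<kappa>\<^sub>2 * (4 * a) \<le> \<kappa>\<^sub>2 * b" using assms by (intro mult_left_mono_neg) auto
  then show ?thesis using False by (simp add: min_def algebra_simps)
qed

text \<open>By shift invariance every inner product of translates of \<open>u\<close> is an
  autocorrelation \<open>s (l - k)\<close>, and \<open>s\<close> is even. The energy becomes
  \<open>\<kappa>\<^sub>1 * a + \<kappa>\<^sub>2 * b\<close>, which is affine in \<open>b\<close> on
  the interval from \<open>0\<close> to \<open>4 * a\<close>. The constant is the smaller of the two
  endpoint values per unit of \<open>a\<close>; the assumptions of the theorem on the force
  constants make it positive.\<close>

lemma energy_l2:
  assumes u: "u \<in> l2"
  shows "min \<kappa>\<^sub>1 (\<kappa>\<^sub>1 + 4 * \<kappa>\<^sub>2) * l2_inner (\<lambda>j. u (j + 1) - u j) (\<lambda>j. u (j + 1) - u j)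
    \<le> l2_inner u (lattice_op \<kappa>\<^sub>1 \<kappa>\<^sub>2 u)"
proof -
  define s where "s k = l2_inner u (\<lambda>j. u (j + k))" for k
  have ss: "l2_inner (\<lambda>j. u (j + k)) (\<lambda>j. u (j + l)) = s (l - k)" for k l
    unfolding s_def using l2_inner_shift[of "\<lambda>j. u (j + k)" u l]
      l2_inner_shift[of u u "l - k"] by (simp add: algebra_simps)
  have s0: "l2_inner (\<lambda>j. u (j + k)) u = s (- k)" "l2_inner u (\<lambda>j. u (j + k)) = s k"
    "l2_inner u u = s 0" for k
    using ss[of k 0] ss[of 0 k] ss[of 0 0] by simp_all
  have sym: "s (- k) = s k" for k
    using s0(1)[of k] s0(2)[of k] by (simp add: l2_inner_commute)
  note lin = l2_inner_diff_right l2_inner_diff_left l2_shift l2_diff u ss s0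
  define a where "a = 2 * s 0 - 2 * s 1"
  define b where "b = 2 * s 0 - 2 * s 2"
  have a: "l2_inner (\<lambda>j. u (j + 1) - u j) (\<lambda>j. u (j + 1) - u j) = a"
    by (simp add: lin a_def sym)
  have "l2_inner (\<lambda>j. u (j + 2) - u j) (\<lambda>j. u (j + 2) - u j) = b"
    by (simp add: lin b_def sym)
  then have b0: "0 \<le> b" using l2_inner_self_nonneg by metis
  \<comment> \<open>\<open>x - y\<close> is the second difference of \<open>u\<close>; its squared
    norm gives \<open>b \<le> 4 * a\<close>.\<close>
  define x y where "x = (\<lambda>j. u (j + 2) - u (j + 1))" and "y = (\<lambda>j. u (j + 1) - u j)"
  have xy: "x \<in> l2" "y \<in> l2" unfolding x_def y_def by (intro l2_diff l2_shift u)+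
  have inner: "l2_inner x x = a" "l2_inner x y = 2 * s 1 - s 0 - s 2"
    "l2_inner y x = 2 * s 1 - s 0 - s 2" "l2_inner y y = a"
    unfolding x_def y_def a_def by (simp_all add: lin sym)
  have "0 \<le> l2_inner (\<lambda>j. x j - y j) (\<lambda>j. x j - y j)" by (rule l2_inner_self_nonneg)
  also have "\<dots> = 4 * a - b"
    by (simp add: l2_inner_diff_left l2_inner_diff_right l2_diff xy inner a_def b_def)
  finally have b4: "b \<le> 4 * a" by simp
  have "l2_inner u (lattice_op \<kappa>\<^sub>1 \<kappa>\<^sub>2 u) = \<kappa>\<^sub>1 * a + \<kappa>\<^sub>2 * b"
    unfolding l2_inner_lattice_op[OF u u] a_def b_def s0(2,3) sym by (simp add: algebra_simps)
  with energy_lower_bound[OF b0 b4] show ?thesis by (simp add: a)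
qed

section \<open>Splitting the integers into blocks; block diagonal operators\<close>

lemma div_mod_block:
  assumes "i < M"
  shows "(J * int M + int i) div int M = J" "(J * int M + int i) mod int M = int i"
  using assms by (simp_all add: div_add1_eq)

lemma bij_block:
  assumes "0 < M"
  shows "bij_betw (\<lambda>(J, i). J * int M + int i) (UNIV \<times> {..<M}) UNIV"
proof (rule bij_betw_byWitness[where f' = "\<lambda>j. (j div int M, nat (j mod int M))"])
  show "\<forall>a\<in>UNIV \<times> {..<M}. ((case a of (J, i) \<Rightarrow> J * int M + int i) div int M,
      nat ((case a of (J, i) \<Rightarrow> J * int M + int i) mod int M)) = a"
    by (auto simp: div_mod_block)
qed (use assms in \<open>auto simp: nat_less_iff\<close>)

lemma infsum_blocks:
  fixes h :: "int \<Rightarrow> real"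
  assumes "0 < M" "h summable_on UNIV"
  shows "(\<Sum>\<^sub>\<infinity>j. h j) = (\<Sum>\<^sub>\<infinity>J. \<Sum>i<M. h (J * int M + int i))"
proof -
  let ?f = "\<lambda>J i. h (J * int M + int i)"
  have "(\<lambda>(J, i). ?f J i) summable_on UNIV \<times> {..<M}"
    using summable_on_reindex_bij_betw[OF bij_block[OF assms(1)], of h] assms(2)
    by (simp add: case_prod_unfold)
  from infsum_Sigma'_banach[OF this] show ?thesis
    using infsum_reindex_bij_betw[OF bij_block[OF assms(1)], of h]
    by (simp add: case_prod_unfold)
qed

text \<open>Nonnegativity matters for the direction from right to left: terms of mixed sign could
  cancel within a block.\<close>

lemma summable_blocks:
  fixes h :: "int \<Rightarrow> real"
  assumes "0 < M" "\<And>j. 0 \<le> h j"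
  shows "h summable_on UNIV \<longleftrightarrow> (\<lambda>J. \<Sum>i<M. h (J * int M + int i)) summable_on UNIV"
proof -
  let ?f = "\<lambda>(J, i). h (J * int M + int i)"
  have "?f summable_on UNIV \<times> {..<M} \<longleftrightarrow> (\<lambda>J. \<Sum>i<M. ?f (J, i)) summable_on UNIV"
  proof
    assume "?f summable_on UNIV \<times> {..<M}"
    from summable_on_Sigma_banach[OF this]
    show "(\<lambda>J. \<Sum>i<M. ?f (J, i)) summable_on UNIV" by simp
  next
    assume "(\<lambda>J. \<Sum>i<M. ?f (J, i)) summable_on UNIV"
    then show "?f summable_on UNIV \<times> {..<M}"
      by (rule summable_on_SigmaI[rotated]) (auto simp: assms)
  qed
  then show ?thesis
    using summable_on_reindex_bij_betw[OF bij_block[OF assms(1)], of h]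
    by (simp add: case_prod_unfold)
qed

lemma block_diag_nth:
  assumes "i < dim_row B"
  shows "block_diag B v (J * int (dim_row B) + int i) =
    (\<Sum>l<dim_col B. B $$ (i, l) * v (J * int (dim_col B) + int l))"
  using assms by (simp add: block_diag_def div_mod_block)

text \<open>Cauchy-Schwarz in each block bounds its squared norm by the squared Frobenius norm
  \<open>?C\<close> of \<open>B\<close> times the squared norm of the corresponding block of
  \<open>v\<close>.\<close>

lemma l2_block_diag:
  assumes B: "B \<in> carrier_mat r c" and "0 < r" "0 < c" and v: "v \<in> l2"
  shows "block_diag B v \<in> l2"
proof -
  let ?C = "\<Sum>i<r. \<Sum>l<c. (B $$ (i, l))\<^sup>2"
  let ?V = "\<lambda>J. \<Sum>l<c. (v (J * int c + int l))\<^sup>2"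
  have "(\<Sum>i<r. (block_diag B v (J * int r + int i))\<^sup>2) \<le> ?C * ?V J" for J
  proof (subst sum_distrib_right, rule sum_mono)
    fix i assume "i \<in> {..<r}"
    then show "(block_diag B v (J * int r + int i))\<^sup>2 \<le> (\<Sum>l<c. (B $$ (i, l))\<^sup>2) * ?V J"
      using block_diag_nth[of i B v J] B
        Cauchy_Schwarz_ineq_sum[of "\<lambda>l. B $$ (i, l)" "\<lambda>l. v (J * int c + int l)" "{..<c}"]
      by simp
  qed
  moreover have "?V summable_on UNIV"
    using v summable_blocks[OF \<open>0 < c\<close>, of "\<lambda>j. (v j)\<^sup>2"] by (simp add: l2_def)
  ultimately have "(\<lambda>J. \<Sum>i<r. (block_diag B v (J * int r + int i))\<^sup>2) summable_on UNIV"
    by - (rule summable_on_comparison_test[OF summable_on_cmult_right[of ?V UNIV ?C]],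
        auto intro: sum_nonneg)
  then show ?thesis
    using summable_blocks[OF \<open>0 < r\<close>, of "\<lambda>j. (block_diag B v j)\<^sup>2"] by (simp add: l2_def)
qed

text \<open>Both inner products are evaluated block by block; within a block the identity is an
  exchange of two finite sums.\<close>

lemma block_diag_adjoint:
  assumes B: "B \<in> carrier_mat r c" and "0 < r" "0 < c" and v: "v \<in> l2" and u: "u \<in> l2"
  shows "l2_inner (block_diag B v) u = l2_inner v (block_diag (transpose_mat B) u)"
proof -
  have Bt: "transpose_mat B \<in> carrier_mat c r" using B by simp
  note bl = block_diag_nth[of _ B] block_diag_nth[of _ "transpose_mat B"]
  have "(\<Sum>i<r. block_diag B v (J * int r + int i) * u (J * int r + int i)) =
      (\<Sum>l<c. v (J * int c + int l) * block_diag (transpose_mat B) u (J * int c + int l))" for J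
  proof -
    have "(\<Sum>i<r. block_diag B v (J * int r + int i) * u (J * int r + int i)) =
        (\<Sum>i<r. \<Sum>l<c. B $$ (i, l) * v (J * int c + int l) * u (J * int r + int i))"
      using bl(1)[of _ v J] B by (simp add: sum_distrib_right)
    also have "\<dots> = (\<Sum>l<c. \<Sum>i<r. B $$ (i, l) * v (J * int c + int l) * u (J * int r + int i))"
      by (rule sum.swap)
    also have "\<dots> = (\<Sum>l<c. v (J * int c + int l) * block_diag (transpose_mat B) u (J * int c + int l))"
      using bl(2)[of _ u J] B by (simp add: sum_distrib_left mult_ac)
    finally show ?thesis .
  qed
  then show ?thesis
    unfolding l2_inner_def
    using infsum_blocks[OF \<open>0 < r\<close> l2_mult_summable[OF l2_block_diag[OF assms(1-4)] u]]
      infsum_blocks[OF \<open>0 < c\<close> l2_mult_summable[OF v l2_block_diag[OF Bt \<open>0 < c\<close> \<open>0 < r\<close> u]]]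
    by simp
qed

abbreviation unit_seq :: "int \<Rightarrow> real" where
  "unit_seq \<equiv> \<lambda>j. if j = 0 then 1 else 0"

lemma l2_unit_seq: "unit_seq \<in> l2"
  unfolding l2_def mem_Collect_eq
  by (rule finite_nonzero_values_imp_summable_on) (rule finite_subset[of _ "{0}"], auto)

lemma l2_inner_unit_seq: "l2_inner unit_seq v = v 0"
proof -
  have "l2_inner unit_seq v = (\<Sum>\<^sub>\<infinity>j\<in>{0}. unit_seq j * v j)"
    unfolding l2_inner_def by (rule infsum_cong_neutral) auto
  then show ?thesis by simp
qed

section \<open>Fourier coefficients and quasi-periodic sequences\<close>

abbreviation character :: "int \<Rightarrow> real \<Rightarrow> complex" where
  "character k \<xi> \<equiv> exp (\<i> * of_int k * complex_of_real \<xi>)"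

lemma character_add: "character (k + l) \<xi> = character k \<xi> * character l \<xi>"
  by (simp add: exp_add[symmetric] algebra_simps)

lemma cnj_character: "cnj (character k \<xi>) = character (- k) \<xi>"
  by (simp add: exp_cnj)

lemma has_integral_character:
  "(character k has_integral (if k = 0 then of_real (2 * pi) else 0)) {0..2 * pi}"
proof (cases "k = 0")
  case True
  then show ?thesis using has_integral_const_real[of "1::complex" 0 "2 * pi"]
    by (simp add: scaleR_conv_of_real)
next
  case False
  let ?F = "\<lambda>\<xi>. character k \<xi> / (\<i> * of_int k)"
  have "(character k has_integral ?F (2 * pi) - ?F 0) {0..2 * pi}"
    by (rule fundamental_theorem_of_calculus)
      (use False in \<open>auto intro!: derivative_eq_intros has_vector_derivative_real_field\<close>)
  moreover have "character k (2 * pi) = 1"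
    using exp_integer_2pi[of "of_int k"] by (simp add: mult_ac)
  ultimately show ?thesis using False by simp
qed

text \<open>For a partial Fourier sum \<open>s\<close>, the integral of the squared modulus of
  \<open>f - s\<close> is nonnegative; expanding it bounds all finite sums of squared coefficients
  by the same number.\<close>

lemma bessel_summable:
  assumes f: "continuous_on {0..2 * pi} f"
    and c: "\<And>J. c J = 1 / (2 * pi) * integral {0..2 * pi} (\<lambda>\<xi>. character J \<xi> * f \<xi>)"
  shows "(\<lambda>J. (cmod (c J))\<^sup>2) summable_on UNIV"
proof (rule nonneg_bdd_above_summable_on)
  let ?I = "{0..2 * pi}"
  define n where "n = integral ?I (\<lambda>\<xi>. f \<xi> * cnj (f \<xi>))"
  have n: "((\<lambda>\<xi>. f \<xi> * cnj (f \<xi>)) has_integral n) ?I"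
    unfolding n_def
    by (intro integrable_integral integrable_continuous_interval continuous_intros f)
  have fJ: "((\<lambda>\<xi>. character J \<xi> * f \<xi>) has_integral 2 * pi * c J) ?I" for J
  proof -
    have "(\<lambda>\<xi>. character J \<xi> * f \<xi>) integrable_on ?I"
      by (intro integrable_continuous_interval continuous_intros f)
    from integrable_integral[OF this] show ?thesis by (simp add: c)
  qed
  have fJ': "((\<lambda>\<xi>. cnj (character J \<xi> * f \<xi>)) has_integral 2 * pi * cnj (c J)) ?I" for J
    using has_integral_cnj[of "\<lambda>\<xi>. character J \<xi> * f \<xi>" "2 * pi * c J"] fJ by (simp add: o_def)
  show "bdd_above (sum (\<lambda>J. (cmod (c J))\<^sup>2) ` {F. F \<subseteq> UNIV \<and> finite F})"
  proof (rule bdd_aboveI2)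
    fix F :: "int set" assume "F \<in> {F. F \<subseteq> UNIV \<and> finite F}"
    then have F: "finite F" by simp
    \<comment> \<open>The coefficients are taken against \<open>character J\<close>, so the partial
      sum is built from the conjugate characters.\<close>
    define s where "s \<xi> = (\<Sum>J\<in>F. c J * character (- J) \<xi>)" for \<xi>
    have "((\<lambda>\<xi>. f \<xi> * cnj (f \<xi>) - (\<Sum>J\<in>F. cnj (c J) * (character J \<xi> * f \<xi>))
          - (\<Sum>J\<in>F. c J * cnj (character J \<xi> * f \<xi>))
          + (\<Sum>J\<in>F. \<Sum>K\<in>F. c J * cnj (c K) * character (K - J) \<xi>)) has_integral
        (n - (\<Sum>J\<in>F. cnj (c J) * (2 * pi * c J)) - (\<Sum>J\<in>F. c J * (2 * pi * cnj (c J)))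
          + (\<Sum>J\<in>F. \<Sum>K\<in>F. c J * cnj (c K) * (if K - J = 0 then of_real (2 * pi) else 0)))) ?I"
      by (intro has_integral_add has_integral_diff has_integral_sum has_integral_mult_right
          n fJ fJ' has_integral_character F)
    \<comment> \<open>Orthogonality of the characters leaves only the diagonal \<open>K = J\<close>;
      the two mixed terms and the double sum then combine to a single subtraction.\<close>
    also have "(\<Sum>J\<in>F. \<Sum>K\<in>F. c J * cnj (c K) * (if K - J = 0 then of_real (2 * pi) else 0))
        = (\<Sum>J\<in>F. c J * (2 * pi * cnj (c J)))"
      using F by (intro sum.cong refl) (simp add: if_distrib sum.delta cong: if_cong)
    also have X: "(\<Sum>J\<in>F. c J * (2 * pi * cnj (c J))) = of_real (2 * pi * (\<Sum>J\<in>F. (cmod (c J))\<^sup>2))"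
      unfolding of_real_mult of_real_sum complex_norm_square sum_distrib_left by (simp add: mult_ac)
    also have "(\<Sum>J\<in>F. cnj (c J) * (2 * pi * c J)) = of_real (2 * pi * (\<Sum>J\<in>F. (cmod (c J))\<^sup>2))"
      unfolding X[symmetric] by (simp add: mult_ac)
    also have "n - of_real (2 * pi * (\<Sum>J\<in>F. (cmod (c J))\<^sup>2))
        - of_real (2 * pi * (\<Sum>J\<in>F. (cmod (c J))\<^sup>2)) + of_real (2 * pi * (\<Sum>J\<in>F. (cmod (c J))\<^sup>2))
        = n - of_real (2 * pi * (\<Sum>J\<in>F. (cmod (c J))\<^sup>2))"
      by simp
    also have "(\<lambda>\<xi>. f \<xi> * cnj (f \<xi>) - (\<Sum>J\<in>F. cnj (c J) * (character J \<xi> * f \<xi>))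
          - (\<Sum>J\<in>F. c J * cnj (character J \<xi> * f \<xi>))
          + (\<Sum>J\<in>F. \<Sum>K\<in>F. c J * cnj (c K) * character (K - J) \<xi>))
        = (\<lambda>\<xi>. (f \<xi> - s \<xi>) * cnj (f \<xi> - s \<xi>))"
    proof
      fix \<xi>
      have 1: "(\<Sum>J\<in>F. cnj (c J) * (character J \<xi> * f \<xi>)) = f \<xi> * cnj (s \<xi>)"
        unfolding s_def by (simp only: cnj_sum complex_cnj_mult cnj_character sum_distrib_left)
          (simp add: mult_ac)
      have 2: "(\<Sum>J\<in>F. c J * cnj (character J \<xi> * f \<xi>)) = s \<xi> * cnj (f \<xi>)"
        unfolding s_def by (simp only: complex_cnj_mult cnj_character sum_distrib_right)
          (simp add: mult_ac)
      have 3: "(\<Sum>J\<in>F. \<Sum>K\<in>F. c J * cnj (c K) * character (K - J) \<xi>) = s \<xi> * cnj (s \<xi>)"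
        unfolding s_def diff_conv_add_uminus character_add
        by (simp only: cnj_sum complex_cnj_mult cnj_character sum_product minus_minus)
          (simp add: mult_ac)
      show "f \<xi> * cnj (f \<xi>) - (\<Sum>J\<in>F. cnj (c J) * (character J \<xi> * f \<xi>))
          - (\<Sum>J\<in>F. c J * cnj (character J \<xi> * f \<xi>))
          + (\<Sum>J\<in>F. \<Sum>K\<in>F. c J * cnj (c K) * character (K - J) \<xi>)
        = (f \<xi> - s \<xi>) * cnj (f \<xi> - s \<xi>)"
        unfolding 1 2 3 by (simp add: algebra_simps)
    qed
    finally have "((\<lambda>\<xi>. (f \<xi> - s \<xi>) * cnj (f \<xi> - s \<xi>)) has_integral
        n - of_real (2 * pi * (\<Sum>J\<in>F. (cmod (c J))\<^sup>2))) ?I" .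
    \<comment> \<open>The integrals so far are complex; taking real parts makes
      \<open>has_integral_nonneg\<close> applicable.\<close>
    from has_integral_linear[OF this bounded_linear_Re]
    have "((\<lambda>\<xi>. (cmod (f \<xi> - s \<xi>))\<^sup>2) has_integral
        Re n - 2 * pi * (\<Sum>J\<in>F. (cmod (c J))\<^sup>2)) ?I"
      by (simp add: o_def complex_norm_square[symmetric] del: complex_cnj_diff)
    from has_integral_nonneg[OF this]
    have "0 \<le> Re n - 2 * pi * (\<Sum>J\<in>F. (cmod (c J))\<^sup>2)"
      by simp
    then show "(\<Sum>J\<in>F. (cmod (c J))\<^sup>2) \<le> Re n / (2 * pi)"
      by (simp add: field_simps)
  qed
qed simp

section \<open>Bloch sequences and their superpositions\<close>

text \<open>A Bloch sequence: block \<open>J\<close> is the vector \<open>y\<close> times the phase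
  \<open>character J \<xi>\<close>. Block Toeplitz operators act on such sequences through their
  symbol; the sign of the exponent is the one for which the super-diagonal block carries the factor
  \<open>exp (\<i> * \<xi>)\<close>.\<close>

definition quasi_periodic :: "nat \<Rightarrow> real \<Rightarrow> complex Matrix.vec \<Rightarrow> int \<Rightarrow> complex" where
  "quasi_periodic r \<xi> y j = character (j div int r) \<xi> * vec_index y (nat (j mod int r))"

text \<open>The inverse Fourier transform of \<open>g\<close>, a superposition of Bloch sequences:
  the entries at position \<open>i\<close> of the blocks are the Fourier coefficients of component
  \<open>i\<close> of \<open>g\<close>.\<close>

definition fourier_seq :: "nat \<Rightarrow> (real \<Rightarrow> complex Matrix.vec) \<Rightarrow> int \<Rightarrow> complex" where
  "fourier_seq r g j =
     1 / (2 * pi) * integral {0..2 * pi} (\<lambda>\<xi>. quasi_periodic r \<xi> (g \<xi>) j)"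

definition cont_vec :: "nat \<Rightarrow> (real \<Rightarrow> complex Matrix.vec) \<Rightarrow> bool" where
  "cont_vec n g \<longleftrightarrow> (\<forall>\<xi>. g \<xi> \<in> carrier_vec n) \<and>
     (\<forall>i<n. continuous_on UNIV (\<lambda>\<xi>. vec_index (g \<xi>) i))"

definition cont_mat :: "nat \<Rightarrow> nat \<Rightarrow> (real \<Rightarrow> complex mat) \<Rightarrow> bool" where
  "cont_mat r c A \<longleftrightarrow> (\<forall>\<xi>. A \<xi> \<in> carrier_mat r c) \<and>
     (\<forall>i<r. \<forall>j<c. continuous_on UNIV (\<lambda>\<xi>. A \<xi> $$ (i, j)))"

lemma continuous_quasi_periodic:
  assumes "cont_vec r g" "0 < r"
  shows "continuous_on {0..2 * pi} (\<lambda>\<xi>. quasi_periodic r \<xi> (g \<xi>) j)"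
proof -
  have "nat (j mod int r) < r" using assms(2) by (simp add: nat_less_iff)
  then have "continuous_on {0..2 * pi} (\<lambda>\<xi>. vec_index (g \<xi>) (nat (j mod int r)))"
    using assms(1) continuous_on_subset unfolding cont_vec_def by blast
  then show ?thesis unfolding quasi_periodic_def by (intro continuous_intros)
qed

text \<open>The operators act on real sequences, whereas Fourier sequences are complex. The
  functional \<open>\<rho>\<close>, later \<open>Re\<close> or \<open>Im\<close>, mediates: it is
  real-linear and so commutes with combinations that have real coefficients \<open>a\<close>.
  Continuity of \<open>g\<close> lets the finite sum move into the integral.\<close>

lemma fourier_seq_combination:
  assumes "bounded_linear \<rho>" "cont_vec r g" "0 < r" "finite K"
  shows "(\<Sum>k\<in>K. a k * \<rho> (fourier_seq r g (m k))) =
    (\<rho> (1 / (2 * pi) * integral {0..2 * pi}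
      (\<lambda>\<xi>. \<Sum>k\<in>K. of_real (a k) * quasi_periodic r \<xi> (g \<xi>) (m k))) :: real)"
proof -
  interpret bounded_linear \<rho> by fact
  have int: "(\<lambda>\<xi>. quasi_periodic r \<xi> (g \<xi>) (m k)) integrable_on {0..2 * pi}" for k
    by (intro integrable_continuous_interval continuous_quasi_periodic assms)
  have "(\<Sum>k\<in>K. a k * \<rho> (fourier_seq r g (m k))) = \<rho> (\<Sum>k\<in>K. of_real (a k) * fourier_seq r g (m k))"
    using scaleR by (simp add: sum scaleR_conv_of_real[symmetric])
  also have "(\<Sum>k\<in>K. of_real (a k) * fourier_seq r g (m k)) = 1 / (2 * pi) *
      (\<Sum>k\<in>K. integral {0..2 * pi} (\<lambda>\<xi>. of_real (a k) * quasi_periodic r \<xi> (g \<xi>) (m k)))"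
    by (simp add: fourier_seq_def sum_distrib_left mult_ac)
  also have "(\<Sum>k\<in>K. integral {0..2 * pi} (\<lambda>\<xi>. of_real (a k) * quasi_periodic r \<xi> (g \<xi>) (m k))) =
      integral {0..2 * pi} (\<lambda>\<xi>. \<Sum>k\<in>K. of_real (a k) * quasi_periodic r \<xi> (g \<xi>) (m k))"
    by (intro integral_sum[symmetric] assms integrable_on_mult_right int)
  finally show ?thesis .
qed

text \<open>All sites of a block share one phase, which factors out of the sum; the block length
  changes from \<open>c\<close> to \<open>r\<close>.\<close>

lemma quasi_periodic_block_diag:
  assumes B: "B \<in> carrier_mat r c" and "0 < r" and y: "y \<in> carrier_vec c"
  shows "(\<Sum>l<c. of_real (B $$ (nat (j mod int r), l)) *
      quasi_periodic c \<xi> y (j div int r * int c + int l)) = quasi_periodic r \<xi> (cmat B *\<^sub>v y) j"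
proof -
  have i: "nat (j mod int r) < r" using assms(2) by (simp add: nat_less_iff)
  have "vec_index (cmat B *\<^sub>v y) (nat (j mod int r)) =
      (\<Sum>l<c. of_real (B $$ (nat (j mod int r), l)) * vec_index y l)"
    using B y i by (simp add: scalar_prod_def lessThan_atLeast0)
  then show ?thesis
    by (simp add: quasi_periodic_def div_mod_block sum_distrib_left mult_ac)
qed

lemma block_diag_fourier_seq:
  assumes B: "B \<in> carrier_mat r c" and "0 < r" "0 < c" and \<rho>: "bounded_linear \<rho>"
    and g: "cont_vec c g"
  shows "block_diag B (\<lambda>j. \<rho> (fourier_seq c g j)) =
    (\<lambda>j. \<rho> (fourier_seq r (\<lambda>\<xi>. cmat B *\<^sub>v g \<xi>) j))"
proof
  fix j
  have "g \<xi> \<in> carrier_vec c" for \<xi> using g by (simp add: cont_vec_def)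
  then show "block_diag B (\<lambda>j. \<rho> (fourier_seq c g j)) j =
      \<rho> (fourier_seq r (\<lambda>\<xi>. cmat B *\<^sub>v g \<xi>) j)"
    using B fourier_seq_combination[OF \<rho> g \<open>0 < c\<close>, of "{..<c}"
        "\<lambda>l. B $$ (nat (j mod int r), l)" "\<lambda>l. j div int r * int c + int l"]
      quasi_periodic_block_diag[OF B \<open>0 < r\<close>]
    by (simp add: block_diag_def fourier_seq_def[of r])
qed

text \<open>For each fixed position in the block, Bessel's inequality applies to the corresponding
  component of \<open>g\<close>, and there are only finitely many positions.\<close>

lemma l2_fourier_seq:
  assumes g: "cont_vec r g" and "0 < r" and \<rho>: "\<And>z. \<bar>\<rho> z\<bar> \<le> cmod z"
  shows "(\<lambda>j. \<rho> (fourier_seq r g j)) \<in> l2"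
proof -
  have rest: "(\<lambda>J. (cmod (fourier_seq r g (J * int r + int i)))\<^sup>2) summable_on UNIV" if "i < r" for i
  proof (rule bessel_summable)
    show "continuous_on {0..2 * pi} (\<lambda>\<xi>. vec_index (g \<xi>) i)"
      using g that continuous_on_subset unfolding cont_vec_def by blast
  qed (simp add: fourier_seq_def quasi_periodic_def div_mod_block that)
  have "(\<lambda>J. \<Sum>i<r. (cmod (fourier_seq r g (J * int r + int i)))\<^sup>2) summable_on UNIV"
  proof -
    have "(\<lambda>J. \<Sum>i\<in>I. (cmod (fourier_seq r g (J * int r + int i)))\<^sup>2) summable_on UNIV"
      if "finite I" "I \<subseteq> {..<r}" for I
      using that by induction (auto intro!: summable_on_add rest)
    from this[of "{..<r}"] show ?thesis by simp
  qed
  then have "(\<lambda>j. (cmod (fourier_seq r g j))\<^sup>2) summable_on UNIV"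
    using summable_blocks[OF \<open>0 < r\<close>, of "\<lambda>j. (cmod (fourier_seq r g j))\<^sup>2"] by simp
  then show ?thesis
    unfolding l2_def mem_Collect_eq
    by (rule summable_on_comparison_test) (simp_all add: abs_le_square_iff[symmetric] \<rho>)
qed

text \<open>A constant function has only its zeroth Fourier coefficient.\<close>

lemma fourier_seq_unit:
  "fourier_seq 1 (\<lambda>_. Matrix.vec 1 (\<lambda>_. 1)) j = of_real (unit_seq j)"
  using integral_unique[OF has_integral_character[of j]]
  by (simp add: fourier_seq_def quasi_periodic_def)

section \<open>The symbol of the lattice operator\<close>

text \<open>The convolution kernel, as a function of the offset between two sites, from which both
  \<open>lattice_op\<close> and the blocks of its symbol can be read off.\<close>

definition lattice_coeff :: "real \<Rightarrow> real \<Rightarrow> int \<Rightarrow> real" where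
  "lattice_coeff \<kappa>\<^sub>1 \<kappa>\<^sub>2 s = (if s = 0 then 2 * (\<kappa>\<^sub>1 + \<kappa>\<^sub>2) else if \<bar>s\<bar> = 1 then - \<kappa>\<^sub>1
     else if \<bar>s\<bar> = 2 then - \<kappa>\<^sub>2 else 0)"

lemma interval_2: "{- 2..2 :: int} = {- 2, - 1, 0, 1, 2}"
  by auto

lemma lattice_op_coeff:
  "lattice_op \<kappa>\<^sub>1 \<kappa>\<^sub>2 u j = (\<Sum>s\<in>{- 2..2}. lattice_coeff \<kappa>\<^sub>1 \<kappa>\<^sub>2 s * u (j + s))"
  unfolding interval_2 by (simp add: lattice_op_def lattice_coeff_def)

lemma symbol_carrier: "symbol \<kappa>\<^sub>1 \<kappa>\<^sub>2 M \<xi> \<in> carrier_mat M M"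
  by (simp add: symbol_def diag_block_def sub_block_def)

text \<open>Site \<open>i\<close> of a block and site \<open>k\<close> of the block \<open>L\<close>
  steps further on are at offset \<open>L * int M + int k - int i\<close>. Since
  \<open>2 \<le> M\<close>, interactions of range two reach only adjacent blocks.\<close>

lemma symbol_nth:
  assumes "2 \<le> M" "i < M" "k < M"
  shows "symbol \<kappa>\<^sub>1 \<kappa>\<^sub>2 M \<xi> $$ (i, k) =
    (\<Sum>L\<in>{- 1, 0, 1}. character L \<xi> * of_real (lattice_coeff \<kappa>\<^sub>1 \<kappa>\<^sub>2 (L * int M + int k - int i)))"
proof -
  have "diag_block \<kappa>\<^sub>1 \<kappa>\<^sub>2 M $$ (i, k) = lattice_coeff \<kappa>\<^sub>1 \<kappa>\<^sub>2 (int k - int i)"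
    using assms by (auto simp: diag_block_def lattice_coeff_def)
  moreover have "sub_block \<kappa>\<^sub>1 \<kappa>\<^sub>2 M $$ (i, k) = lattice_coeff \<kappa>\<^sub>1 \<kappa>\<^sub>2 (- int M + int k - int i)"
    using assms by (auto simp: sub_block_def lattice_coeff_def)
  moreover have "sub_block \<kappa>\<^sub>1 \<kappa>\<^sub>2 M $$ (k, i) = lattice_coeff \<kappa>\<^sub>1 \<kappa>\<^sub>2 (int M + int k - int i)"
    using assms by (auto simp: sub_block_def lattice_coeff_def)
  ultimately show ?thesis
    using assms by (simp add: symbol_def diag_block_def sub_block_def)
qed

lemma quasi_periodic_shift:
  assumes "0 < M"
  shows "quasi_periodic M \<xi> y (J * int M + j) = character J \<xi> * quasi_periodic M \<xi> y j"
  using assms by (simp add: quasi_periodic_def exp_add[symmetric] algebra_simps)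

text \<open>Row \<open>i\<close> of the symbol applied to \<open>y\<close> is a sum over positions
  \<open>k\<close> and block offsets \<open>L\<close>. The phases in \<open>symbol_nth\<close> turn
  component \<open>k\<close> of \<open>y\<close> into the Bloch sequence at site
  \<open>L * M + k\<close>, so the row is the convolution at site \<open>i\<close> of block
  \<open>0\<close>; block \<open>J\<close> follows by a phase factor.\<close>

lemma quasi_periodic_lattice_op:
  assumes M: "2 \<le> M" and y: "y \<in> carrier_vec M"
  shows "(\<Sum>s\<in>{- 2..2}. of_real (lattice_coeff \<kappa>\<^sub>1 \<kappa>\<^sub>2 s) * quasi_periodic M \<xi> y (j + s)) =
    quasi_periodic M \<xi> (symbol \<kappa>\<^sub>1 \<kappa>\<^sub>2 M \<xi> *\<^sub>v y) j"
proof -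
  let ?Y = "quasi_periodic M \<xi> y"
  define i where "i = nat (j mod int M)"
  define J where "J = j div int M"
  have i: "i < M" and j: "j = J * int M + int i"
    using M by (simp_all add: i_def J_def nat_less_iff)
  let ?c = "\<lambda>m. of_real (lattice_coeff \<kappa>\<^sub>1 \<kappa>\<^sub>2 (m - int i)) * ?Y m"
  have "vec_index (symbol \<kappa>\<^sub>1 \<kappa>\<^sub>2 M \<xi> *\<^sub>v y) i =
      (\<Sum>k<M. symbol \<kappa>\<^sub>1 \<kappa>\<^sub>2 M \<xi> $$ (i, k) * vec_index y k)"
    using i y symbol_carrier[of \<kappa>\<^sub>1 \<kappa>\<^sub>2 M \<xi>] by (simp add: scalar_prod_def lessThan_atLeast0)
  also have "\<dots> = (\<Sum>k<M. \<Sum>L\<in>{- 1, 0, 1}. ?c (L * int M + int k))"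
    by (intro sum.cong refl, simp only: symbol_nth[OF M i] lessThan_iff sum_distrib_right,
        intro sum.cong refl) (simp add: quasi_periodic_def div_mod_block mult_ac)
  also have "\<dots> = (\<Sum>(k, L)\<in>{..<M} \<times> {- 1, 0, 1}. ?c (L * int M + int k))"
    by (rule sum.cartesian_product)
  \<comment> \<open>The pairs \<open>(k, L)\<close> enumerate the sites of the three blocks
    \<open>- 1\<close>, \<open>0\<close> and \<open>1\<close>.\<close>
  also have "\<dots> = (\<Sum>m\<in>{- int M..<2 * int M}. ?c m)"
  proof (rule sum.reindex_bij_witness[where i = "\<lambda>m. (nat (m mod int M), m div int M)"
        and j = "\<lambda>(k, L). L * int M + int k"])
    fix m assume m: "m \<in> {- int M..<2 * int M}"
    have "- 1 \<le> m div int M"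
      using m M zdiv_mono1[of "- int M" m "int M"] by (simp add: zdiv_zminus1_eq_if)
    moreover have "m div int M \<le> 1"
      using m M zdiv_mono1[of m "1 * int M + int (M - 1)" "int M"]
        div_mod_block(1)[of "M - 1" M 1] by auto
    ultimately have "m div int M = - 1 \<or> m div int M = 0 \<or> m div int M = 1" by linarith
    then show "(nat (m mod int M), m div int M) \<in> {..<M} \<times> {- 1, 0, 1}"
      using M by (auto simp: nat_less_iff)
  qed (use M in \<open>auto simp: div_mod_block div_mod_block[of _ M "- 1", simplified]\<close>)
  \<comment> \<open>The window around \<open>i\<close> lies within the three blocks because
    \<open>i < M\<close> and \<open>2 \<le> M\<close>; outside it the kernel vanishes.\<close>
  also have "\<dots> = (\<Sum>m\<in>{int i - 2..int i + 2}. ?c m)"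
    by (rule sum.mono_neutral_right) (use i M in \<open>auto simp: lattice_coeff_def\<close>)
  also have "\<dots> = (\<Sum>s\<in>{- 2..2}. of_real (lattice_coeff \<kappa>\<^sub>1 \<kappa>\<^sub>2 s) * ?Y (int i + s))"
    by (rule sum.reindex_bij_witness[where i = "\<lambda>s. int i + s" and j = "\<lambda>m. m - int i"]) auto
  finally have *: "vec_index (symbol \<kappa>\<^sub>1 \<kappa>\<^sub>2 M \<xi> *\<^sub>v y) i =
    (\<Sum>s\<in>{- 2..2}. of_real (lattice_coeff \<kappa>\<^sub>1 \<kappa>\<^sub>2 s) * ?Y (int i + s))" .
  have "?Y (j + s) = character J \<xi> * ?Y (int i + s)" for s
    using quasi_periodic_shift[of M \<xi> y J "int i + s"] M by (simp add: j add.assoc)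
  then show ?thesis
    unfolding quasi_periodic_def[of M \<xi> "symbol \<kappa>\<^sub>1 \<kappa>\<^sub>2 M \<xi> *\<^sub>v y"] J_def[symmetric] i_def[symmetric] *
    by (simp only: sum_distrib_left mult_ac)
qed

lemma lattice_op_fourier_seq:
  assumes M: "2 \<le> M" and \<rho>: "bounded_linear \<rho>" and g: "cont_vec M g"
  shows "lattice_op \<kappa>\<^sub>1 \<kappa>\<^sub>2 (\<lambda>j. \<rho> (fourier_seq M g j)) =
    (\<lambda>j. \<rho> (fourier_seq M (\<lambda>\<xi>. symbol \<kappa>\<^sub>1 \<kappa>\<^sub>2 M \<xi> *\<^sub>v g \<xi>) j))"
proof
  fix j
  have "g \<xi> \<in> carrier_vec M" for \<xi> using g by (simp add: cont_vec_def)
  then show "lattice_op \<kappa>\<^sub>1 \<kappa>\<^sub>2 (\<lambda>j. \<rho> (fourier_seq M g j)) j =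
      \<rho> (fourier_seq M (\<lambda>\<xi>. symbol \<kappa>\<^sub>1 \<kappa>\<^sub>2 M \<xi> *\<^sub>v g \<xi>) j)"
    using fourier_seq_combination[OF \<rho> g, of "{- 2..2}" "lattice_coeff \<kappa>\<^sub>1 \<kappa>\<^sub>2" "\<lambda>s. j + s"] M
    by (simp add: lattice_op_coeff quasi_periodic_lattice_op
        fourier_seq_def[of M "\<lambda>\<xi>. symbol \<kappa>\<^sub>1 \<kappa>\<^sub>2 M \<xi> *\<^sub>v g \<xi>"])
qed

section \<open>Invertibility of the compressed symbol\<close>

lemma cont_mat_const: "A \<in> carrier_mat r c \<Longrightarrow> cont_mat r c (\<lambda>_. A)"
  by (simp add: cont_mat_def)

lemma cont_mat_mult:
  assumes A: "cont_mat r n A" and B: "cont_mat n c B"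
  shows "cont_mat r c (\<lambda>\<xi>. A \<xi> * B \<xi>)"
proof -
  have "continuous_on UNIV (\<lambda>\<xi>. (A \<xi> * B \<xi>) $$ (i, j))" if ij: "i < r" "j < c" for i j
  proof -
    have "(A \<xi> * B \<xi>) $$ (i, j) = (\<Sum>k<n. A \<xi> $$ (i, k) * B \<xi> $$ (k, j))" for \<xi>
    proof -
      have "A \<xi> \<in> carrier_mat r n" "B \<xi> \<in> carrier_mat n c" using A B by (simp_all add: cont_mat_def)
      then show ?thesis using ij by (simp add: scalar_prod_def lessThan_atLeast0)
    qed
    then show ?thesis
      using A B ij by (auto simp: cont_mat_def intro!: continuous_on_sum continuous_on_mult)
  qed
  then show ?thesis using A B by (auto simp: cont_mat_def intro: mult_carrier_mat)
qed

lemma cont_vec_mult: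
  assumes A: "cont_mat r n A" and g: "cont_vec n g"
  shows "cont_vec r (\<lambda>\<xi>. A \<xi> *\<^sub>v g \<xi>)"
proof -
  have "continuous_on UNIV (\<lambda>\<xi>. vec_index (A \<xi> *\<^sub>v g \<xi>) i)" if i: "i < r" for i
  proof -
    have "vec_index (A \<xi> *\<^sub>v g \<xi>) i = (\<Sum>k<n. A \<xi> $$ (i, k) * vec_index (g \<xi>) k)" for \<xi>
    proof -
      have "A \<xi> \<in> carrier_mat r n" "g \<xi> \<in> carrier_vec n"
        using A g by (simp_all add: cont_mat_def cont_vec_def)
      then show ?thesis using i by (simp add: scalar_prod_def lessThan_atLeast0)
    qed
    then show ?thesis
      using A g i
      by (auto simp: cont_mat_def cont_vec_def intro!: continuous_on_sum continuous_on_mult)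
  qed
  then show ?thesis using A g
    by (auto simp: cont_mat_def cont_vec_def intro: mult_mat_vec_carrier)
qed

lemma cont_vec_const: "v \<in> carrier_vec n \<Longrightarrow> cont_vec n (\<lambda>_. v)"
  by (simp add: cont_vec_def)

lemma cont_mat_symbol: "cont_mat M M (symbol \<kappa>\<^sub>1 \<kappa>\<^sub>2 M)"
proof -
  have dims: "diag_block \<kappa>\<^sub>1 \<kappa>\<^sub>2 M \<in> carrier_mat M M" "sub_block \<kappa>\<^sub>1 \<kappa>\<^sub>2 M \<in> carrier_mat M M"
    by (simp_all add: diag_block_def sub_block_def)
  have "continuous_on UNIV (\<lambda>\<xi>. symbol \<kappa>\<^sub>1 \<kappa>\<^sub>2 M \<xi> $$ (i, j))" if "i < M" "j < M" for i j
  proof -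
    have "symbol \<kappa>\<^sub>1 \<kappa>\<^sub>2 M \<xi> $$ (i, j) = of_real (diag_block \<kappa>\<^sub>1 \<kappa>\<^sub>2 M $$ (i, j))
        + exp (- \<i> * complex_of_real \<xi>) * of_real (sub_block \<kappa>\<^sub>1 \<kappa>\<^sub>2 M $$ (i, j))
        + exp (\<i> * complex_of_real \<xi>) * of_real (sub_block \<kappa>\<^sub>1 \<kappa>\<^sub>2 M $$ (j, i))" for \<xi>
      using dims that by (simp add: symbol_def)
    then show ?thesis by (simp only:) (intro continuous_intros)
  qed
  then show ?thesis by (simp add: cont_mat_def symbol_carrier)
qed

text \<open>Leibniz's formula makes the determinant a polynomial in the entries.\<close>

lemma continuous_det:
  assumes "cont_mat n n A"
  shows "continuous_on UNIV (\<lambda>\<xi>. Determinant.det (A \<xi>))"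
proof -
  have "Determinant.det (A \<xi>) = (\<Sum>p\<in>{p. p permutes {0..<n}}.
      signof p * (\<Prod>i = 0..<n. A \<xi> $$ (i, p i)))" for \<xi>
    using assms by (intro det_def') (simp add: cont_mat_def)
  moreover have "p i < n" if "p permutes {0..<n}" "i < n" for p i
    using permutes_in_image[OF that(1), of i] that(2) by simp
  ultimately show ?thesis
    using assms by (auto simp: cont_mat_def intro!: continuous_on_sum continuous_on_mult
        continuous_on_prod continuous_on_const)
qed

lemma the_mat_inverse:
  fixes A :: "complex mat"
  assumes A: "A \<in> carrier_mat n n" and det: "Determinant.det A \<noteq> 0"
  shows "the (mat_inverse A) \<in> carrier_mat n n" "A * the (mat_inverse A) = 1\<^sub>m n"
    "the (mat_inverse A) * A = 1\<^sub>m n"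
  using mat_inverse(1)[OF A, of "()"] mat_inverse(2)[OF A] det_non_zero_imp_unit[OF A det, of "()"]
  by (cases "mat_inverse A"; auto)+

text \<open>Cramer's rule: each entry of the inverse is a cofactor divided by the determinant, hence
  a quotient of continuous functions.\<close>

lemma cont_mat_inverse:
  assumes A: "cont_mat n n A" and det: "\<And>\<xi>. Determinant.det (A \<xi>) \<noteq> 0"
  shows "cont_mat n n (\<lambda>\<xi>. the (mat_inverse (A \<xi>)))"
proof -
  have car: "A \<xi> \<in> carrier_mat n n" for \<xi> using A by (simp add: cont_mat_def)
  note inv = the_mat_inverse[OF car det]
  have adj: "adj_mat (A \<xi>) = Determinant.det (A \<xi>) \<cdot>\<^sub>m the (mat_inverse (A \<xi>))" for \<xi>
  proof -
    let ?B = "the (mat_inverse (A \<xi>))"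
    have "adj_mat (A \<xi>) = ?B * A \<xi> * adj_mat (A \<xi>)"
      using inv(3)[of \<xi>] left_mult_one_mat[OF adj_mat(1)[OF car[of \<xi>]]] by simp
    also have "\<dots> = ?B * (A \<xi> * adj_mat (A \<xi>))"
      by (rule assoc_mult_mat[OF inv(1) car adj_mat(1)[OF car]])
    also have "\<dots> = Determinant.det (A \<xi>) \<cdot>\<^sub>m ?B"
      using mult_smult_distrib[OF inv(1)[of \<xi>] one_carrier_mat] right_mult_one_mat[OF inv(1)[of \<xi>]]
      by (simp add: adj_mat(2)[OF car])
    finally show ?thesis .
  qed
  have "continuous_on UNIV (\<lambda>\<xi>. the (mat_inverse (A \<xi>)) $$ (i, j))" if ij: "i < n" "j < n" for i j
  proof -
    have "the (mat_inverse (A \<xi>)) $$ (i, j) =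
        (- 1) ^ (j + i) * Determinant.det (mat_delete (A \<xi>) j i) / Determinant.det (A \<xi>)" for \<xi>
    proof -
      have "adj_mat (A \<xi>) $$ (i, j) =
          Determinant.det (A \<xi>) * the (mat_inverse (A \<xi>)) $$ (i, j)"
        using inv(1)[of \<xi>] ij by (simp add: adj)
      moreover have "adj_mat (A \<xi>) $$ (i, j) =
          (- 1) ^ (j + i) * Determinant.det (mat_delete (A \<xi>) j i)"
        using car[of \<xi>] ij by (simp add: adj_mat_def cofactor_def)
      ultimately show ?thesis using det[of \<xi>] by (simp add: field_simps)
    qed
    moreover have minor: "cont_mat (n - 1) (n - 1) (\<lambda>\<xi>. mat_delete (A \<xi>) j i)"
    proof -
      have "continuous_on UNIV (\<lambda>\<xi>. mat_delete (A \<xi>) j i $$ (k, l))"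
        if kl: "k < n - 1" "l < n - 1" for k l
      proof -
        \<comment> \<open>Deleting row \<open>j\<close> and column \<open>i\<close> shifts the later
          indices by one.\<close>
        define k' l' where "k' = (if k < j then k else Suc k)" and "l' = (if l < i then l else Suc l)"
        have "mat_delete (A \<xi>) j i $$ (k, l) = A \<xi> $$ (k', l')" for \<xi>
          using car[of \<xi>] kl by (simp add: mat_delete_def k'_def l'_def)
        moreover have "k' < n" "l' < n" using kl by (auto simp: k'_def l'_def)
        ultimately show ?thesis using A by (simp add: cont_mat_def)
      qed
      then show ?thesis using mat_delete_carrier[OF car] by (simp add: cont_mat_def)
    qed
    ultimately show ?thesis
      using continuous_on_divide[OF continuous_on_mult[OF continuous_on_const
          continuous_det[OF minor]] continuous_det[OF A]] det by simp
  qed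
  then show ?thesis by (simp add: cont_mat_def inv(1))
qed

section \<open>Positivity of the symbol modulo constants\<close>

text \<open>A shift by one changes the sum by \<open>h (int M + t) - h t\<close>, which periodicity
  makes zero; induction in both directions covers negative shifts.\<close>

lemma sum_periodic_shift:
  fixes h :: "int \<Rightarrow> 'a::ab_group_add"
  assumes "\<And>j. h (j + int M) = h j"
  shows "(\<Sum>i<M. h (int i + t)) = (\<Sum>i<M. h (int i))"
proof -
  have step: "(\<Sum>i<M. h (int i + (t + 1))) = (\<Sum>i<M. h (int i + t))" for t
  proof -
    have "(\<Sum>i<M. h (int (Suc i) + t) - h (int i + t)) = h (int M + t) - h (int 0 + t)"
      by (rule sum_lessThan_telescope)
    then show ?thesis
      using assms[of t] by (simp add: sum_subtractf algebra_simps)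
  qed
  show ?thesis
  proof (induction t rule: int_induct[where k = 0])
    case (step1 t) then show ?case using step[of t] by simp
  next
    case (step2 t) then show ?case using step[of "t - 1"] by simp
  qed simp
qed

text \<open>The counterpart of \<open>energy_l2\<close> over one block. Sums of the products
  \<open>G k\<close> over a block are shift invariant, so the same computation with
  \<open>a\<close>, \<open>b\<close> and second differences applies. A vanishing form forces
  \<open>a = 0\<close>, and all first differences of \<open>Y\<close> within the block
  vanish.\<close>

lemma symbol_form_zero_imp_const:
  assumes M: "2 \<le> M" and \<kappa>: "\<kappa>\<^sub>1 > 0" "\<kappa>\<^sub>1 + 4 * \<kappa>\<^sub>2 > 0" and y: "y \<in> carrier_vec M"
    and zero: "(\<Sum>i<M. cnj (vec_index y i) * vec_index (symbol \<kappa>\<^sub>1 \<kappa>\<^sub>2 M \<xi> *\<^sub>v y) i) = 0"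
    and "i < M"
  shows "vec_index y i = vec_index y 0"
proof -
  define Y where "Y = quasi_periodic M \<xi> y"
  have Y: "Y (int i) = vec_index y i" if "i < M" for i
    using that by (simp add: Y_def quasi_periodic_def)
  \<comment> \<open>\<open>G k\<close> is periodic although \<open>Y\<close> is only quasi-periodic:
    the phases of the two factors cancel.\<close>
  define G where "G k j = Re (cnj (Y j) * Y (j + k))" for k j
  define s where "s k = (\<Sum>i<M. G k (int i))" for k
  have "G k (j + int M) = G k j" for k j
  proof -
    have "Y (m + int M) = character 1 \<xi> * Y m" for m
      using quasi_periodic_shift[of M \<xi> y 1 m] M by (simp add: Y_def add.commute)
    from this[of j] this[of "j + k"] have "cnj (Y (j + int M)) * Y (j + int M + k) =
        (cnj (character 1 \<xi>) * character 1 \<xi>) * (cnj (Y j) * Y (j + k))"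
      by (simp add: algebra_simps)
    also have "cnj (character 1 \<xi>) * character 1 \<xi> = 1"
      unfolding cnj_character character_add[symmetric] by simp
    finally show ?thesis by (simp add: G_def)
  qed
  from sum_periodic_shift[of "G _", OF this]
  have shift: "(\<Sum>i<M. G k (int i + t)) = s k" for k t by (simp add: s_def)
  define a where "a = (\<Sum>i<M. (cmod (Y (int i + 1) - Y (int i)))\<^sup>2)"
  define b where "b = (\<Sum>i<M. (cmod (Y (int i + 2) - Y (int i)))\<^sup>2)"
  have "(cmod (Y (j + 1) - Y j))\<^sup>2 = G 0 (j + 1) + G 0 j - 2 * G 1 j" for j
    unfolding cmod_power2 G_def by (simp add: power2_eq_square algebra_simps)
  then have a: "a = 2 * s 0 - 2 * s 1"
    using shift[of _ 0] by (simp add: a_def sum_subtractf sum.distrib shift sum_distrib_left[symmetric])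
  have "(cmod (Y (j + 2) - Y j))\<^sup>2 = G 0 (j + 2) + G 0 j - 2 * G 2 j" for j
    unfolding cmod_power2 G_def by (simp add: power2_eq_square algebra_simps)
  then have b: "b = 2 * s 0 - 2 * s 2"
    using shift[of _ 0] by (simp add: b_def sum_subtractf sum.distrib shift sum_distrib_left[symmetric])
  have "(cmod (Y (j + 2) - 2 * Y (j + 1) + Y j))\<^sup>2 =
      G 0 (j + 2) + 4 * G 0 (j + 1) + G 0 j - 4 * G 1 (j + 1) - 4 * G 1 j + 2 * G 2 j" for j
    unfolding cmod_power2 G_def by (simp add: power2_eq_square algebra_simps)
  then have "(\<Sum>i<M. (cmod (Y (int i + 2) - 2 * Y (int i + 1) + Y (int i)))\<^sup>2) = 4 * a - b"
    using shift[of _ 0]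
    by (simp add: a b sum_subtractf sum.distrib shift sum_distrib_left[symmetric])
  moreover have "0 \<le> (\<Sum>i<M. (cmod (Y (int i + 2) - 2 * Y (int i + 1) + Y (int i)))\<^sup>2)"
    by (intro sum_nonneg) simp
  ultimately have b4: "b \<le> 4 * a" by simp
  have b0: "0 \<le> b" unfolding b_def by (intro sum_nonneg) simp
  have "Re (cnj (Y j) * (\<Sum>s\<in>{- 2..2}. of_real (lattice_coeff \<kappa>\<^sub>1 \<kappa>\<^sub>2 s) * Y (j + s))) =
      2 * (\<kappa>\<^sub>1 + \<kappa>\<^sub>2) * G 0 j - \<kappa>\<^sub>1 * (G 1 j + G 1 (j + (- 1))) - \<kappa>\<^sub>2 * (G 2 j + G 2 (j + (- 2)))"
    for j unfolding interval_2 by (simp add: lattice_coeff_def G_def algebra_simps)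
  \<comment> \<open>The hypothesis on the symbol becomes one on the convolution, where shift
    invariance can be used.\<close>
  moreover have "(\<Sum>i<M. cnj (Y (int i)) *
      (\<Sum>s\<in>{- 2..2}. of_real (lattice_coeff \<kappa>\<^sub>1 \<kappa>\<^sub>2 s) * Y (int i + s))) = 0"
    using zero unfolding Y_def quasi_periodic_lattice_op[OF M y] by (simp add: quasi_periodic_def)
  then have "(\<Sum>i<M. Re (cnj (Y (int i)) *
      (\<Sum>s\<in>{- 2..2}. of_real (lattice_coeff \<kappa>\<^sub>1 \<kappa>\<^sub>2 s) * Y (int i + s)))) = 0"
    unfolding Re_sum[symmetric] by (simp only: zero_complex.sel)
  ultimately have "0 = (\<Sum>i<M. 2 * (\<kappa>\<^sub>1 + \<kappa>\<^sub>2) * G 0 (int i) -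
      \<kappa>\<^sub>1 * (G 1 (int i) + G 1 (int i + (- 1))) - \<kappa>\<^sub>2 * (G 2 (int i) + G 2 (int i + (- 2))))"
    by simp
  also have "\<dots> = \<kappa>\<^sub>1 * a + \<kappa>\<^sub>2 * b"
    unfolding sum_subtractf sum_distrib_left[symmetric] sum.distrib shift s_def[symmetric] a b
    by (simp add: algebra_simps)
  finally have "min \<kappa>\<^sub>1 (\<kappa>\<^sub>1 + 4 * \<kappa>\<^sub>2) * a \<le> 0"
    using energy_lower_bound[OF b0 b4, of \<kappa>\<^sub>1 \<kappa>\<^sub>2] by simp
  then have "a \<le> 0" using \<kappa> by (auto simp: mult_le_0_iff min_def split: if_splits)
  moreover have "0 \<le> a" unfolding a_def by (intro sum_nonneg) simp
  ultimately have "a = 0" by simp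
  then have const: "Y (int i + 1) = Y (int i)" if "i < M" for i
    using that unfolding a_def by (subst (asm) sum_nonneg_eq_0_iff) auto
  show ?thesis using \<open>i < M\<close>
  proof (induction i)
    case (Suc i)
    then show ?case using const[of i] Y[of i] Y[of "Suc i"] by (simp add: add.commute)
  qed simp
qed

section \<open>The complementary columns and the compressed symbol\<close>

lemma complementary_cols_carrier:
  "complementary_cols M Q2 \<Longrightarrow> Q2 \<in> carrier_mat M (M - 1)"
  by (simp add: complementary_cols_def)

text \<open>Both facts are entries of the identity that expresses orthonormality of the columns of
  \<open>?P\<close>. Column \<open>0\<close> of \<open>?P\<close> is constant, and column
  \<open>l\<close> of \<open>Q2\<close> sits at \<open>Suc l\<close>; orthogonality to the constant
  column gives the vanishing sum.\<close>

lemma complementary_cols_orthonormal: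
  assumes "complementary_cols M Q2" "l < M - 1" "l' < M - 1"
  shows "(\<Sum>i<M. Q2 $$ (i, l) * Q2 $$ (i, l')) = (if l = l' then 1 else 0)"
    and "(\<Sum>i<M. Q2 $$ (i, l)) = 0"
proof -
  let ?P = "hcat (avg_col M) Q2"
  have Q: "dim_row Q2 = M" "dim_col Q2 = M - 1"
    using complementary_cols_carrier[OF assms(1)] by auto
  have P: "?P \<in> carrier_mat M M" using Q assms(2) by (simp add: hcat_def avg_col_def)
  have eq: "transpose_mat ?P * ?P = 1\<^sub>m M"
    using assms(1) P by (auto simp: complementary_cols_def orthogonal_square_mat_def)
  have ent: "(\<Sum>i<M. ?P $$ (i, m) * ?P $$ (i, n)) = (if m = n then 1 else 0)"
    if "m < M" "n < M" for m n
    using arg_cong[OF eq, of "\<lambda>B. B $$ (m, n)"] P that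
    by (simp add: scalar_prod_def lessThan_atLeast0)
  show "(\<Sum>i<M. Q2 $$ (i, l) * Q2 $$ (i, l')) = (if l = l' then 1 else 0)"
    using ent[of "Suc l" "Suc l'"] assms(2,3) Q by (simp add: hcat_def avg_col_def)
  have "(\<Sum>i<M. 1 / sqrt (real M) * Q2 $$ (i, l)) = 0"
    using ent[of 0 "Suc l"] assms(2,3) Q by (simp add: hcat_def avg_col_def)
  then show "(\<Sum>i<M. Q2 $$ (i, l)) = 0"
    using assms(2) by (auto simp: sum_divide_distrib[symmetric])
qed

text \<open>A kernel vector \<open>x\<close> yields \<open>y = Q2 x\<close> with vanishing quadratic
  form, so \<open>y\<close> is constant. The columns of \<open>Q2\<close> are orthonormal and sum to
  zero, hence \<open>x = Q2^T y = 0\<close>.\<close>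

lemma det_compressed_symbol:
  assumes M: "2 \<le> M" and \<kappa>: "\<kappa>\<^sub>1 > 0" "\<kappa>\<^sub>1 + 4 * \<kappa>\<^sub>2 > 0" and Q: "complementary_cols M Q2"
  shows "Determinant.det (transpose_mat (cmat Q2) * symbol \<kappa>\<^sub>1 \<kappa>\<^sub>2 M \<xi> * cmat Q2) \<noteq> 0"
proof
  let ?q = "cmat Q2" and ?A = "symbol \<kappa>\<^sub>1 \<kappa>\<^sub>2 M \<xi>"
  have q: "?q \<in> carrier_mat M (M - 1)" "transpose_mat ?q \<in> carrier_mat (M - 1) M"
    using complementary_cols_carrier[OF Q] by auto
  note A = symbol_carrier[of \<kappa>\<^sub>1 \<kappa>\<^sub>2 M \<xi>]
  have S: "transpose_mat ?q * ?A * ?q \<in> carrier_mat (M - 1) (M - 1)" using q A by auto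
  assume "Determinant.det (transpose_mat ?q * ?A * ?q) = 0"
  then obtain x where x: "x \<in> carrier_vec (M - 1)" "x \<noteq> 0\<^sub>v (M - 1)"
    and Sx: "(transpose_mat ?q * ?A * ?q) *\<^sub>v x = 0\<^sub>v (M - 1)"
    using det_0_iff_vec_prod_zero_field[OF S] by blast
  define y where "y = ?q *\<^sub>v x"
  have y: "y \<in> carrier_vec M" using q x by (simp add: y_def)
  have qAy: "transpose_mat ?q *\<^sub>v (?A *\<^sub>v y) = 0\<^sub>v (M - 1)"
  proof -
    have "(transpose_mat ?q * ?A * ?q) *\<^sub>v x = (transpose_mat ?q * ?A) *\<^sub>v y"
      unfolding y_def by (rule assoc_mult_mat_vec[OF mult_carrier_mat[OF q(2) A] q(1) x(1)])
    also have "\<dots> = transpose_mat ?q *\<^sub>v (?A *\<^sub>v y)"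
      by (rule assoc_mult_mat_vec[OF q(2) A y])
    finally show ?thesis using Sx by simp
  qed
  have qv: "(\<Sum>i<M. of_real (Q2 $$ (i, l)) * vec_index v i) = vec_index (transpose_mat ?q *\<^sub>v v) l"
    if "v \<in> carrier_vec M" "l < M - 1" for v l
    using that complementary_cols_carrier[OF Q] by (simp add: scalar_prod_def lessThan_atLeast0)
  have yi: "vec_index y i = (\<Sum>l<M - 1. of_real (Q2 $$ (i, l)) * vec_index x l)" if "i < M" for i
    using that x complementary_cols_carrier[OF Q]
    by (simp add: y_def scalar_prod_def lessThan_atLeast0)
  let ?z = "?A *\<^sub>v y"
  have z: "?z \<in> carrier_vec M" using A y by simp
  \<comment> \<open>\<open>Q2\<close> is real, so it moves to the other factor as its transpose,
    where \<open>qAy\<close> applies.\<close>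
  have "(\<Sum>i<M. cnj (vec_index y i) * vec_index ?z i) =
      (\<Sum>i<M. \<Sum>l<M - 1. cnj (vec_index x l) * (of_real (Q2 $$ (i, l)) * vec_index ?z i))"
    by (simp add: yi sum_distrib_left sum_distrib_right mult_ac)
  also have "\<dots> = (\<Sum>l<M - 1. cnj (vec_index x l) * (\<Sum>i<M. of_real (Q2 $$ (i, l)) * vec_index ?z i))"
    unfolding sum_distrib_left by (rule sum.swap)
  also have "\<dots> = 0" using qv[OF z] by (simp add: qAy)
  finally have const: "vec_index y i = vec_index y 0" if "i < M" for i
    using symbol_form_zero_imp_const[OF M \<kappa> y] that by blast
  have "vec_index x l = 0" if l: "l < M - 1" for l
  proof -
    have "(\<Sum>i<M. of_real (Q2 $$ (i, l)) * vec_index y i) =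
        (\<Sum>i<M. \<Sum>m<M - 1. of_real (Q2 $$ (i, l) * Q2 $$ (i, m)) * vec_index x m)"
      by (simp add: yi sum_distrib_left mult_ac)
    also have "\<dots> = (\<Sum>m<M - 1. of_real (\<Sum>i<M. Q2 $$ (i, l) * Q2 $$ (i, m)) * vec_index x m)"
      unfolding of_real_sum sum_distrib_right by (rule sum.swap)
    also have "\<dots> = (\<Sum>m<M - 1. if l = m then vec_index x m else 0)"
      by (intro sum.cong refl) (simp add: complementary_cols_orthonormal(1)[OF Q l])
    also have "\<dots> = vec_index x l" using l by simp
    finally have "vec_index x l = (\<Sum>i<M. of_real (Q2 $$ (i, l)) * vec_index y i)" by simp
    also have "\<dots> = (\<Sum>i<M. of_real (Q2 $$ (i, l)) * vec_index y 0)"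
      by (rule sum.cong[OF refl]) (metis const lessThan_iff)
    also have "\<dots> = of_real (\<Sum>i<M. Q2 $$ (i, l)) * vec_index y 0"
      by (simp add: sum_distrib_right)
    finally show ?thesis using complementary_cols_orthonormal(2)[OF Q l l] by simp
  qed
  then have "x = 0\<^sub>v (M - 1)" using x(1) by (intro eq_vecI) auto
  with x(2) show False by simp
qed

section \<open>The memory kernel\<close>

lemma block_diag_diff:
  "block_diag B (\<lambda>j. u j - v j) = (\<lambda>j. block_diag B u j - block_diag B v j)"
  by (simp add: fun_eq_iff block_diag_def right_diff_distrib sum_subtractf)

lemma lattice_op_diff:
  "lattice_op \<kappa>\<^sub>1 \<kappa>\<^sub>2 (\<lambda>j. u j - v j) =
    (\<lambda>j. lattice_op \<kappa>\<^sub>1 \<kappa>\<^sub>2 u j - lattice_op \<kappa>\<^sub>1 \<kappa>\<^sub>2 v j)"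
  by (simp add: fun_eq_iff lattice_op_def algebra_simps)

lemma block_diag_const:
  "block_diag B (\<lambda>_. c) j = (\<Sum>l<dim_col B. B $$ (nat (j mod int (dim_row B)), l)) * c"
  by (simp add: block_diag_def sum_distrib_right)

text \<open>In each block this is the orthonormality of the columns of \<open>Q2\<close>.\<close>

lemma block_diag_transpose_cancel:
  assumes Q: "complementary_cols M Q2" and M: "2 \<le> M"
  shows "block_diag (transpose_mat Q2) (block_diag Q2 v) = v"
proof
  fix j
  define N where "N = M - 1"
  have N: "0 < N" and c: "dim_row Q2 = M" "dim_col Q2 = N"
    using M complementary_cols_carrier[OF Q] by (auto simp: N_def)
  define J where "J = j div int N"
  define l where "l = nat (j mod int N)"
  have l: "l < N" and j: "j = J * int N + int l"
    using N by (simp_all add: J_def l_def nat_less_iff)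
  have "block_diag (transpose_mat Q2) (block_diag Q2 v) j =
      (\<Sum>i<M. Q2 $$ (i, l) * (\<Sum>m<N. Q2 $$ (i, m) * v (J * int N + int m)))"
    using block_diag_nth[of l "transpose_mat Q2" "block_diag Q2 v" J] block_diag_nth[of _ Q2 v J] c l
    by (simp add: j)
  also have "\<dots> = (\<Sum>i<M. \<Sum>m<N. Q2 $$ (i, l) * Q2 $$ (i, m) * v (J * int N + int m))"
    by (simp add: sum_distrib_left mult.assoc)
  also have "\<dots> = (\<Sum>m<N. (\<Sum>i<M. Q2 $$ (i, l) * Q2 $$ (i, m)) * v (J * int N + int m))"
    unfolding sum_distrib_right by (rule sum.swap)
  also have "\<dots> = (\<Sum>m<N. if l = m then v (J * int N + int m) else 0)"
    using complementary_cols_orthonormal(1)[OF Q] l by (intro sum.cong refl) (simp add: N_def)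
  also have "\<dots> = v j" using l by (simp add: j)
  finally show "block_diag (transpose_mat Q2) (block_diag Q2 v) j = v j" .
qed

text \<open>The difference \<open>v\<close> of two preimages of the same sequence gives
  \<open>u = \<Psi> v\<close> of zero energy, so \<open>u\<close> is constant, and
  \<open>v = \<Psi>^T u\<close> vanishes because the columns of \<open>Q2\<close> sum to zero.
  Injectivity makes \<open>inv_into\<close> in \<open>memory_kernel\<close> return a solution found
  by other means.\<close>

lemma Omega_sq_inj_on:
  assumes M: "2 \<le> M" and \<kappa>: "\<kappa>\<^sub>1 > 0" "\<kappa>\<^sub>1 + 4 * \<kappa>\<^sub>2 > 0" and Q: "complementary_cols M Q2"
  shows "inj_on (Omega_sq \<kappa>\<^sub>1 \<kappa>\<^sub>2 Q2) l2"
proof (rule inj_onI)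
  fix v\<^sub>1 v\<^sub>2
  assume v: "v\<^sub>1 \<in> l2" "v\<^sub>2 \<in> l2" and eq: "Omega_sq \<kappa>\<^sub>1 \<kappa>\<^sub>2 Q2 v\<^sub>1 = Omega_sq \<kappa>\<^sub>1 \<kappa>\<^sub>2 Q2 v\<^sub>2"
  note c = complementary_cols_carrier[OF Q]
  define v where "v = (\<lambda>j. v\<^sub>1 j - v\<^sub>2 j)"
  define u where "u = block_diag Q2 v"
  have v2: "v \<in> l2" unfolding v_def by (intro l2_diff v)
  have u2: "u \<in> l2" unfolding u_def by (rule l2_block_diag[OF c _ _ v2]) (use M in auto)
  have "block_diag (transpose_mat Q2) (lattice_op \<kappa>\<^sub>1 \<kappa>\<^sub>2 u) = (\<lambda>_. 0)"
    using eq by (simp add: u_def v_def block_diag_diff lattice_op_diff Omega_sq_def fun_eq_iff)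
  then have "l2_inner u (lattice_op \<kappa>\<^sub>1 \<kappa>\<^sub>2 u) = 0"
    using block_diag_adjoint[OF c _ _ v2 l2_lattice_op[OF u2]] M
    by (simp add: u_def[symmetric]) (simp add: l2_inner_def)
  with energy_l2[OF u2, of \<kappa>\<^sub>1 \<kappa>\<^sub>2]
  have "l2_inner (\<lambda>j. u (j + 1) - u j) (\<lambda>j. u (j + 1) - u j) \<le> 0"
    using \<kappa> by (auto simp: mult_le_0_iff min_def split: if_splits)
  from l2_inner_self_eq_0[OF l2_diff[OF l2_shift[OF u2] u2] this]
  have step: "u (j + 1) = u j" for j by simp
  have "u j = u 0" for j
  proof (induction j rule: int_induct[where k = 0])
    case (step1 i) then show ?case using step[of i] by simp
  next
    case (step2 i) then show ?case using step[of "i - 1"] by simp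
  qed simp
  then have "u = (\<lambda>_. u 0)" by auto
  then have "v = block_diag (transpose_mat Q2) (\<lambda>_. u 0)"
    using block_diag_transpose_cancel[OF Q M, of v] by (simp add: u_def)
  moreover have "block_diag (transpose_mat Q2) (\<lambda>_. u 0) j = 0" for j
  proof -
    define N where "N = M - 1"
    have dims: "dim_row Q2 = M" "dim_col Q2 = N" using c by (auto simp: N_def)
    have "nat (j mod int N) < N" using M by (simp add: N_def nat_less_iff)
    then have "(\<Sum>l<M. transpose_mat Q2 $$ (nat (j mod int N), l)) = 0"
      using complementary_cols_orthonormal(2)[OF Q, folded N_def] dims by simp
    then show ?thesis by (simp add: block_diag_const dims)
  qed
  ultimately have "v = (\<lambda>_. 0)" by auto
  then show "v\<^sub>1 = v\<^sub>2" by (simp add: v_def fun_eq_iff)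
qed

section \<open>Bounds for the kernel entry\<close>

lemma avg_col_carrier: "avg_col M \<in> carrier_mat M 1"
  by (simp add: avg_col_def)

text \<open>Counts the overlap of an interval of \<open>M\<close> integers with a translate of
  itself.\<close>

lemma sum_indicator_shift:
  fixes s :: int
  assumes "\<bar>s\<bar> \<le> int M"
  shows "(\<Sum>l<M. if 0 \<le> int l + s \<and> int l + s < int M then 1 else (0::real)) = real M - real_of_int \<bar>s\<bar>"
proof -
  have "(\<Sum>l<M. if 0 \<le> int l + s \<and> int l + s < int M then 1 else (0::real)) =
      (\<Sum>l\<in>{nat (- s)..<nat (min (int M) (int M - s))}. 1)"
    by (rule sum.mono_neutral_cong_right) auto
  also have "\<dots> = real (nat (min (int M) (int M - s)) - nat (- s))" by simp
  also have "\<dots> = real M - real_of_int \<bar>s\<bar>"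
    using assms by (cases "0 \<le> s") (auto simp: of_nat_diff)
  finally show ?thesis .
qed

text \<open>The sequence \<open>p\<close> is \<open>1 / sqrt M\<close> on block \<open>0\<close> and
  zero elsewhere, so the entry is \<open>1 / M\<close> times the sum of the coefficients weighted by
  the overlaps \<open>M - \<bar>s\<bar>\<close>. The coefficients sum to zero, which removes the
  weight \<open>M\<close>; the weights \<open>- \<bar>s\<bar>\<close> leave a numerator independent
  of \<open>M\<close>.\<close>

lemma averaged_lattice_op:
  assumes M: "2 \<le> M"
  shows "block_diag (transpose_mat (avg_col M)) (lattice_op \<kappa>\<^sub>1 \<kappa>\<^sub>2 (block_diag (avg_col M) unit_seq)) 0 =
    (2 * \<kappa>\<^sub>1 + 4 * \<kappa>\<^sub>2) / real M"
proof -
  define p where "p = block_diag (avg_col M) unit_seq"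
  have p: "p j = 1 / sqrt (real M) * (if 0 \<le> j \<and> j < int M then 1 else 0)" for j
  proof -
    have "j div int M = 0 \<longleftrightarrow> 0 \<le> j \<and> j < int M"
      using M by (auto simp: div_eq_0_iff zdiv_eq_0_iff)
    then show ?thesis
      using M by (simp add: p_def block_diag_def avg_col_def nat_less_iff)
  qed
  have "block_diag (transpose_mat (avg_col M)) (lattice_op \<kappa>\<^sub>1 \<kappa>\<^sub>2 p) 0 =
      1 / sqrt (real M) * (\<Sum>l<M. lattice_op \<kappa>\<^sub>1 \<kappa>\<^sub>2 p (int l))"
    by (simp add: block_diag_def avg_col_def sum_distrib_left)
  also have "(\<Sum>l<M. lattice_op \<kappa>\<^sub>1 \<kappa>\<^sub>2 p (int l)) = (\<Sum>s\<in>{- 2..2}. lattice_coeff \<kappa>\<^sub>1 \<kappa>\<^sub>2 s *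
      (1 / sqrt (real M) * (\<Sum>l<M. if 0 \<le> int l + s \<and> int l + s < int M then 1 else 0)))"
    unfolding lattice_op_coeff p sum_distrib_left by (rule sum.swap)
  also have "\<dots> = (\<Sum>s\<in>{- 2..2}. lattice_coeff \<kappa>\<^sub>1 \<kappa>\<^sub>2 s *
      (1 / sqrt (real M) * (real M - real_of_int \<bar>s\<bar>)))"
    using M by (intro sum.cong refl arg_cong2[where f = "(*)"] sum_indicator_shift) auto
  also have "\<dots> = 1 / sqrt (real M) *
      (\<Sum>s\<in>{- 2..2}. lattice_coeff \<kappa>\<^sub>1 \<kappa>\<^sub>2 s * (real M - real_of_int \<bar>s\<bar>))"
    by (simp add: sum_divide_distrib)
  also have "(\<Sum>s\<in>{- 2..2}. lattice_coeff \<kappa>\<^sub>1 \<kappa>\<^sub>2 s * (real M - real_of_int \<bar>s\<bar>)) =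
      2 * \<kappa>\<^sub>1 + 4 * \<kappa>\<^sub>2"
    unfolding interval_2 by (simp add: lattice_coeff_def algebra_simps)
  finally show ?thesis using M by (simp add: p_def)
qed

text \<open>The equation for \<open>w\<close> makes \<open>p - u\<close> orthogonal to the range of
  \<open>block_diag Q2\<close> in the energy form. Thus \<open>u\<close> is the energy projection of
  \<open>p\<close> onto that range, and the upper bound is Pythagoras.\<close>

lemma memory_kernel_bounds:
  assumes M: "2 \<le> M" and \<kappa>: "\<kappa>\<^sub>1 > 0" "\<kappa>\<^sub>1 + 4 * \<kappa>\<^sub>2 > 0" and Q: "complementary_cols M Q2"
    and w: "w \<in> l2"
    and eq: "Omega_sq \<kappa>\<^sub>1 \<kappa>\<^sub>2 Q2 w =
      block_diag (transpose_mat Q2) (lattice_op \<kappa>\<^sub>1 \<kappa>\<^sub>2 (block_diag (avg_col M) unit_seq))"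
    and \<theta>: "\<theta> = block_diag (transpose_mat (avg_col M)) (lattice_op \<kappa>\<^sub>1 \<kappa>\<^sub>2 (block_diag Q2 w)) 0"
  shows "0 \<le> \<theta>" "\<theta> \<le> (2 * \<kappa>\<^sub>1 + 4 * \<kappa>\<^sub>2) / real M"
proof -
  let ?A = "lattice_op \<kappa>\<^sub>1 \<kappa>\<^sub>2"
  define p where "p = block_diag (avg_col M) unit_seq"
  define u where "u = block_diag Q2 w"
  note c = complementary_cols_carrier[OF Q]
  have N: "0 < M" "0 < M - 1" using M by auto
  have p2: "p \<in> l2" unfolding p_def by (rule l2_block_diag[OF avg_col_carrier N(1) _ l2_unit_seq]) simp
  have u2: "u \<in> l2" unfolding u_def by (rule l2_block_diag[OF c N w])
  have nonneg: "0 \<le> l2_inner x (?A x)" if "x \<in> l2" for x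
  proof -
    have "0 \<le> min \<kappa>\<^sub>1 (\<kappa>\<^sub>1 + 4 * \<kappa>\<^sub>2) * l2_inner (\<lambda>j. x (j + 1) - x j) (\<lambda>j. x (j + 1) - x j)"
      using \<kappa> by (intro mult_nonneg_nonneg l2_inner_self_nonneg) simp
    then show ?thesis using energy_l2[OF that, of \<kappa>\<^sub>1 \<kappa>\<^sub>2] by linarith
  qed
  have coarse: "block_diag (transpose_mat (avg_col M)) x 0 = l2_inner p x" if "x \<in> l2" for x
    using block_diag_adjoint[OF avg_col_carrier N(1) _ l2_unit_seq that]
    by (simp add: p_def l2_inner_unit_seq)
  have fine: "l2_inner u x = l2_inner w (block_diag (transpose_mat Q2) x)" if "x \<in> l2" for x
    unfolding u_def by (rule block_diag_adjoint[OF c N w that])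
  note A2 = l2_lattice_op[OF p2] l2_lattice_op[OF u2]
  have \<theta>p: "\<theta> = l2_inner p (?A u)" using coarse[OF A2(2)] by (simp add: \<theta> u_def)
  also have "\<dots> = l2_inner u (?A p)"
    using lattice_op_symmetric[OF p2 u2] by (simp add: l2_inner_commute)
  finally have \<theta>u: "\<theta> = l2_inner u (?A p)" .
  \<comment> \<open>Galerkin orthogonality: \<open>u\<close> lies in the range of
    \<open>block_diag Q2\<close>, and by \<open>eq\<close> the transposed operator maps
    \<open>?A p\<close> and \<open>?A u\<close> to the same sequence.\<close>
  also have "\<dots> = l2_inner u (?A u)"
    unfolding fine[OF A2(1)] fine[OF A2(2)]
    using eq by (simp add: Omega_sq_def p_def u_def)
  finally have \<theta>uu: "\<theta> = l2_inner u (?A u)" .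
  show "0 \<le> \<theta>" unfolding \<theta>uu by (rule nonneg[OF u2])
  have pp: "l2_inner p (?A p) = (2 * \<kappa>\<^sub>1 + 4 * \<kappa>\<^sub>2) / real M"
    using averaged_lattice_op[OF M] coarse[OF A2(1)] by (simp add: p_def)
  have "0 \<le> l2_inner (\<lambda>j. p j - u j) (?A (\<lambda>j. p j - u j))"
    by (intro nonneg l2_diff p2 u2)
  also have "\<dots> = l2_inner p (?A p) - l2_inner p (?A u) - (l2_inner u (?A p) - l2_inner u (?A u))"
    unfolding lattice_op_diff
    by (simp add: l2_inner_diff_left l2_inner_diff_right l2_diff A2 p2 u2)
  finally show "\<theta> \<le> (2 * \<kappa>\<^sub>1 + 4 * \<kappa>\<^sub>2) / real M"
    unfolding pp \<theta>p[symmetric] \<theta>u[symmetric] \<theta>uu[symmetric] by simp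
qed

section \<open>Time zero and the integral formula\<close>

text \<open>Only the term \<open>k = 0\<close> survives, with \<open>0 ^ 0 = 1\<close>, so the
  series is finite for every \<open>S\<close>.\<close>

lemma cos_sqrt_0: "cos_sqrt S 0 = id"
proof (intro ext)
  fix v j
  have "cos_sqrt S 0 v j = (\<Sum>k\<in>{0}. (- 1) ^ k * 0 ^ (2 * k) / fact (2 * k) * (S ^^ k) v j)"
    unfolding cos_sqrt_def by (rule suminf_finite) auto
  then show "cos_sqrt S 0 v j = id v j" by simp
qed

theorem theorem1:
  fixes M :: nat and \<kappa>\<^sub>1 \<kappa>\<^sub>2 :: real and Q2 :: "real mat"
  assumes "M \<ge> 2"
    and "\<kappa>\<^sub>1 > 0"
    and "\<kappa>\<^sub>1 + 4 * \<kappa>\<^sub>2 > 0"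
    and "complementary_cols M Q2"
  shows "let \<Theta> = (\<lambda>t. op_entry (memory_kernel \<kappa>\<^sub>1 \<kappa>\<^sub>2 M Q2 t)) in
           complex_of_real (\<Theta> 0 0 0) =
             1 / (2 * pi) * integral {0..2 * pi} (\<lambda>\<xi>. kernel_symbol \<kappa>\<^sub>1 \<kappa>\<^sub>2 M Q2 \<xi> $$ (0, 0)) \<and>
           0 \<le> \<Theta> 0 0 0 \<and>
           \<Theta> 0 0 0 \<le> (2 * \<kappa>\<^sub>1 + 4 * \<kappa>\<^sub>2) / real M"
proof -
  note M = assms(1) and \<kappa> = assms(2,3) and Q = assms(4)
  note Q_car = complementary_cols_carrier[OF Q]
  define N where "N = M - 1"
  have N: "0 < M" "0 < N" using M by (auto simp: N_def)
  have one: "0 < (1::nat)" by simp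
  define q1 where "q1 = cmat (avg_col M)"
  define q2 where "q2 = cmat Q2"
  define A where "A = symbol \<kappa>\<^sub>1 \<kappa>\<^sub>2 M"
  \<comment> \<open>The transform of the unit sequence, by \<open>fourier_seq_unit\<close>.\<close>
  define e :: "complex Matrix.vec" where "e = Matrix.vec 1 (\<lambda>_. 1)"
  define S where "S \<xi> = transpose_mat q2 * A \<xi> * q2" for \<xi>
  define R where "R \<xi> = the (mat_inverse (S \<xi>))" for \<xi>
  \<comment> \<open>\<open>b\<close> is the transform of the right-hand side of the equation for
    \<open>w\<close>, and \<open>f\<close> that of its solution, obtained pointwise in
    \<open>\<xi>\<close>.\<close>
  define b where "b \<xi> = transpose_mat q2 *\<^sub>v (A \<xi> *\<^sub>v (q1 *\<^sub>v e))" for \<xi>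
  define f where "f \<xi> = R \<xi> *\<^sub>v b \<xi>" for \<xi>
  have q: "q1 \<in> carrier_mat M 1" "q2 \<in> carrier_mat M N"
    "transpose_mat q1 \<in> carrier_mat 1 M" "transpose_mat q2 \<in> carrier_mat N M"
    using Q_car avg_col_carrier[of M] by (auto simp: q1_def q2_def N_def)
  have A: "A \<xi> \<in> carrier_mat M M" for \<xi> by (simp add: A_def symbol_carrier)
  have e: "e \<in> carrier_vec 1" by (simp add: e_def)
  have contA: "cont_mat M M A" by (simp add: A_def cont_mat_symbol)
  have contS: "cont_mat N N S"
    unfolding S_def by (intro cont_mat_mult[where n = M] cont_mat_const contA q)
  then have S: "S \<xi> \<in> carrier_mat N N" for \<xi> by (simp add: cont_mat_def)
  have det: "Determinant.det (S \<xi>) \<noteq> 0" for \<xi>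
    using det_compressed_symbol[OF M \<kappa> Q] by (simp add: S_def q2_def A_def)
  have contR: "cont_mat N N R" unfolding R_def by (rule cont_mat_inverse[OF contS det])
  then have R: "R \<xi> \<in> carrier_mat N N" for \<xi> by (simp add: cont_mat_def)
  have contq1: "cont_vec M (\<lambda>\<xi>. q1 *\<^sub>v e)"
    using q e by (intro cont_vec_const) simp
  have contAq1: "cont_vec M (\<lambda>\<xi>. A \<xi> *\<^sub>v (q1 *\<^sub>v e))" by (rule cont_vec_mult[OF contA contq1])
  have contb: "cont_vec N b"
    unfolding b_def by (rule cont_vec_mult[OF cont_mat_const[OF q(4)] contAq1])
  have contf: "cont_vec N f" unfolding f_def by (rule cont_vec_mult[OF contR contb])
  have contq2f: "cont_vec M (\<lambda>\<xi>. q2 *\<^sub>v f \<xi>)"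
    by (rule cont_vec_mult[OF cont_mat_const[OF q(2)] contf])
  have contAq2f: "cont_vec M (\<lambda>\<xi>. A \<xi> *\<^sub>v (q2 *\<^sub>v f \<xi>))"
    by (rule cont_vec_mult[OF contA contq2f])
  have fb: "f \<xi> \<in> carrier_vec N" "b \<xi> \<in> carrier_vec N" for \<xi>
    using contf contb by (simp_all add: cont_vec_def)
  have Sf: "transpose_mat q2 *\<^sub>v (A \<xi> *\<^sub>v (q2 *\<^sub>v f \<xi>)) = b \<xi>" for \<xi>
  proof -
    have "transpose_mat q2 *\<^sub>v (A \<xi> *\<^sub>v (q2 *\<^sub>v f \<xi>)) = S \<xi> *\<^sub>v f \<xi>"
      unfolding S_def
      using assoc_mult_mat_vec[OF mult_carrier_mat[OF q(4) A] q(2) fb(1), of \<xi> \<xi>]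
        assoc_mult_mat_vec[OF q(4) A mult_mat_vec_carrier[OF q(2) fb(1)], of \<xi> \<xi>] by simp
    also have "\<dots> = (S \<xi> * R \<xi>) *\<^sub>v b \<xi>"
      unfolding f_def by (rule assoc_mult_mat_vec[OF S R fb(2), symmetric])
    also have "\<dots> = b \<xi>"
      using the_mat_inverse(2)[OF S det] fb(2) by (simp add: R_def)
    finally show ?thesis .
  qed
  let ?K = "\<lambda>\<xi>. kernel_symbol \<kappa>\<^sub>1 \<kappa>\<^sub>2 M Q2 \<xi> $$ (0, 0)"
  define I where "I = 1 / (2 * pi) * integral {0..2 * pi} ?K"
  \<comment> \<open>Reassociating the product and applying it to \<open>e\<close> recovers the
    integrand, the only entry of a \<open>1\<close> by \<open>1\<close> matrix.\<close>
  have K: "vec_index (transpose_mat q1 *\<^sub>v (A \<xi> *\<^sub>v (q2 *\<^sub>v f \<xi>))) 0 = ?K \<xi>" for \<xi>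
  proof -
    let ?L = "transpose_mat q1 * A \<xi> * q2" and ?B = "transpose_mat q2 * A \<xi> * q1"
    have L: "?L \<in> carrier_mat 1 N" "?B \<in> carrier_mat N 1" using q A by auto
    have "transpose_mat q1 *\<^sub>v (A \<xi> *\<^sub>v (q2 *\<^sub>v f \<xi>)) = ?L *\<^sub>v f \<xi>"
      using assoc_mult_mat_vec[OF mult_carrier_mat[OF q(3) A] q(2) fb(1), of \<xi> \<xi>]
        assoc_mult_mat_vec[OF q(3) A mult_mat_vec_carrier[OF q(2) fb(1)], of \<xi> \<xi>] by simp
    also have "\<dots> = (?L * R \<xi>) *\<^sub>v b \<xi>"
      unfolding f_def by (rule assoc_mult_mat_vec[OF L(1) R fb(2), symmetric])
    also have "b \<xi> = ?B *\<^sub>v e"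
      unfolding b_def
      using assoc_mult_mat_vec[OF mult_carrier_mat[OF q(4) A] q(1) e, of \<xi>]
        assoc_mult_mat_vec[OF q(4) A mult_mat_vec_carrier[OF q(1) e], of \<xi>] by simp
    also have "(?L * R \<xi>) *\<^sub>v (?B *\<^sub>v e) = (?L * R \<xi> * ?B) *\<^sub>v e"
      by (rule assoc_mult_mat_vec[OF mult_carrier_mat[OF L(1) R] L(2) e, symmetric])
    also have "?L * R \<xi> * ?B = kernel_symbol \<kappa>\<^sub>1 \<kappa>\<^sub>2 M Q2 \<xi>"
      by (simp add: kernel_symbol_def Let_def R_def S_def A_def q1_def q2_def)
    finally have "transpose_mat q1 *\<^sub>v (A \<xi> *\<^sub>v (q2 *\<^sub>v f \<xi>)) =
      kernel_symbol \<kappa>\<^sub>1 \<kappa>\<^sub>2 M Q2 \<xi> *\<^sub>v e" .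
    moreover have "kernel_symbol \<kappa>\<^sub>1 \<kappa>\<^sub>2 M Q2 \<xi> \<in> carrier_mat 1 1"
      using mult_carrier_mat[OF mult_carrier_mat[OF L(1) R] L(2)]
      by (simp add: kernel_symbol_def Let_def R_def S_def A_def q1_def q2_def)
    ultimately show ?thesis by (simp add: e_def scalar_prod_def)
  qed
  \<comment> \<open>The parameter \<open>\<rho>\<close> lets one computation serve both the real and
    the imaginary part.\<close>
  define \<delta> where "\<delta> \<rho> j = (\<rho> (fourier_seq 1 (\<lambda>_. e) j) :: real)" for \<rho> j
  define w where "w \<rho> j = (\<rho> (fourier_seq N f j) :: real)" for \<rho> j
  note cts = q1_def[symmetric] q2_def[symmetric] A_def[symmetric]
  have transpose: "cmat (transpose_mat Q2) = transpose_mat q2"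
    "cmat (transpose_mat (avg_col M)) = transpose_mat q1"
    by (auto simp: q1_def q2_def)
  have Q': "Q2 \<in> carrier_mat M N" "transpose_mat Q2 \<in> carrier_mat N M"
    "transpose_mat (avg_col M) \<in> carrier_mat 1 M"
    using Q_car avg_col_carrier[of M] by (auto simp: N_def)
  have Omega: "Omega_sq \<kappa>\<^sub>1 \<kappa>\<^sub>2 Q2 (w \<rho>) =
      block_diag (transpose_mat Q2) (lattice_op \<kappa>\<^sub>1 \<kappa>\<^sub>2 (block_diag (avg_col M) (\<delta> \<rho>)))"
    and Theta: "block_diag (transpose_mat (avg_col M)) (lattice_op \<kappa>\<^sub>1 \<kappa>\<^sub>2 (block_diag Q2 (w \<rho>))) 0 = \<rho> I"
    if \<rho>: "bounded_linear \<rho>" for \<rho>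
  proof -
    have u: "lattice_op \<kappa>\<^sub>1 \<kappa>\<^sub>2 (block_diag Q2 (w \<rho>)) =
        (\<lambda>j. \<rho> (fourier_seq M (\<lambda>\<xi>. A \<xi> *\<^sub>v (q2 *\<^sub>v f \<xi>)) j))"
      unfolding w_def block_diag_fourier_seq[OF Q'(1) N \<rho> contf] cts
        lattice_op_fourier_seq[OF M \<rho> contq2f] ..
    have p: "lattice_op \<kappa>\<^sub>1 \<kappa>\<^sub>2 (block_diag (avg_col M) (\<delta> \<rho>)) =
        (\<lambda>j. \<rho> (fourier_seq M (\<lambda>\<xi>. A \<xi> *\<^sub>v (q1 *\<^sub>v e)) j))"
      unfolding \<delta>_def block_diag_fourier_seq[OF avg_col_carrier[of M] N(1) one \<rho> cont_vec_const[OF e]]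
        cts lattice_op_fourier_seq[OF M \<rho> contq1] ..
    show "Omega_sq \<kappa>\<^sub>1 \<kappa>\<^sub>2 Q2 (w \<rho>) =
        block_diag (transpose_mat Q2) (lattice_op \<kappa>\<^sub>1 \<kappa>\<^sub>2 (block_diag (avg_col M) (\<delta> \<rho>)))"
      unfolding Omega_sq_def o_def u p block_diag_fourier_seq[OF Q'(2) N(2,1) \<rho> contAq2f]
        block_diag_fourier_seq[OF Q'(2) N(2,1) \<rho> contAq1] transpose Sf b_def[symmetric] ..
    \<comment> \<open>On the coarse scale blocks have length \<open>1\<close>, so the phase at site
      \<open>0\<close> is trivial and the entry is the mean of the integrand.\<close>
    show "block_diag (transpose_mat (avg_col M)) (lattice_op \<kappa>\<^sub>1 \<kappa>\<^sub>2 (block_diag Q2 (w \<rho>))) 0 = \<rho> I"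
      unfolding u block_diag_fourier_seq[OF Q'(3) one N(1) \<rho> contAq2f] transpose
      by (simp add: fourier_seq_def quasi_periodic_def K I_def)
  qed
  have \<delta>: "\<delta> Re = unit_seq" "\<delta> Im = (\<lambda>_. 0)"
    unfolding \<delta>_def e_def fourier_seq_unit by auto
  have w: "w Re \<in> l2" "w Im \<in> l2"
    unfolding w_def by (rule l2_fourier_seq[OF contf N(2)]; simp add: abs_Re_le_cmod abs_Im_le_cmod)+
  note inj = Omega_sq_inj_on[OF M \<kappa> Q]
  have zero: "block_diag B (\<lambda>_. 0) = (\<lambda>_. 0)" "lattice_op \<kappa>\<^sub>1 \<kappa>\<^sub>2 (\<lambda>_. 0) = (\<lambda>_. 0)" for B
    by (simp_all add: block_diag_def lattice_op_def fun_eq_iff)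
  \<comment> \<open>The imaginary part solves the homogeneous equation, so injectivity makes the integral real.\<close>
  have "w Im = (\<lambda>_. 0)"
  proof (rule inj_onD[OF inj _ w(2)])
    show "Omega_sq \<kappa>\<^sub>1 \<kappa>\<^sub>2 Q2 (w Im) = Omega_sq \<kappa>\<^sub>1 \<kappa>\<^sub>2 Q2 (\<lambda>_. 0)"
      unfolding Omega[OF bounded_linear_Im] \<delta> zero by (simp add: Omega_sq_def zero)
  qed (simp add: l2_def)
  then have "Im I = 0" using Theta[OF bounded_linear_Im] by (simp add: zero)
  moreover have \<Theta>: "op_entry (memory_kernel \<kappa>\<^sub>1 \<kappa>\<^sub>2 M Q2 0) 0 0 = Re I"
  proof -
    \<comment> \<open>At time zero the cosine is the identity, and the argument of
      \<open>inv_into\<close> is the image of \<open>w Re\<close>, an element of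
      \<open>l2\<close>.\<close>
    have "op_entry (memory_kernel \<kappa>\<^sub>1 \<kappa>\<^sub>2 M Q2 0) 0 0 =
        block_diag (transpose_mat (avg_col M)) (lattice_op \<kappa>\<^sub>1 \<kappa>\<^sub>2 (block_diag Q2
          (inv_into l2 (Omega_sq \<kappa>\<^sub>1 \<kappa>\<^sub>2 Q2) (Omega_sq \<kappa>\<^sub>1 \<kappa>\<^sub>2 Q2 (w Re))))) 0"
      unfolding Omega[OF bounded_linear_Re] \<delta>
      by (simp add: op_entry_def memory_kernel_def cos_sqrt_0)
    also have "\<dots> = Re I"
      unfolding inv_into_f_f[OF inj w(1)] by (rule Theta[OF bounded_linear_Re])
    finally show ?thesis .
  qed
  moreover have "0 \<le> Re I" "Re I \<le> (2 * \<kappa>\<^sub>1 + 4 * \<kappa>\<^sub>2) / real M"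
    using memory_kernel_bounds[OF M \<kappa> Q w(1) Omega[OF bounded_linear_Re, unfolded \<delta>] refl]
      Theta[OF bounded_linear_Re] by simp_all
  ultimately show ?thesis
    unfolding Let_def \<Theta> I_def[symmetric] by (simp add: complex_eq_iff)
qed

end
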